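(* Let $G\ge L$ and $K\ge H$ be group–subgroup pairs, let $N=N_K(H)$, let $\theta:L\to N$ be a fixed homomorphism, and let $\widetilde H\le H$ be a subgroup that is normal in $N$ and such that $A:=H/\widetilde H$ is abelian. With the notation of the context, for each $G$-action $\rho$ on $A$ the following statements hold. (1) There is a restriction map $\mathrm{Res}:[L\widetilde H]^\theta\mathrm{mo}(G,N)_\rho\to[LH]^\theta\mathrm{mo}(G,N)_\rho$, $\mathrm{Res}(\langle f\rangle)=[f]$, where $\langle f\rangle$ and $[f]$ are the equivalence classes in $[L\widetilde H]^\theta\mathrm{mo}(G,N)_\rho$ and $[LH]^\theta\mathrm{mo}(G,N)_\rho$. (2) The abelian group $Z^1(G,L;(A,\rho))$ acts freely on the set $[L\widetilde H]^\theta\mathrm{mo}(G,N)_\rho$ by $\gamma\cdot\langle f\rangle:=\langle\dot\gamma f\rangle$, where $\dot\gamma f(x)=\dot\gamma(x)f(x)$ for all $x\in G$, and $\dot\gamma:G\xrightarrow{\gamma}A\to H$ is a lift of $\gamma$ to a map $G\to H$ with $\dot\gamma(1)=1$. (3) The corestricted restriction map $\mathrm{Res}:[L\widetilde H]^\theta\mathrm{mo}(G,N)_\rho\to\mathrm{Im}(\mathrm{Res})$ is a quotient map by the $Z^1(G,L;(A,\rho))$-action. (4) Two classes $\langle f\rangle,\langle g\rangle\in[L\widetilde H]^\theta\mathrm{mo}(G,N)_\rho$ lie in the same $B^1(G,L;(A,\rho))$-orbit if and only if there exist $h\in H$, $f'\in\langle f\rangle$, $g'\in\langle g\rangle$ such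 that $[f(L),h]\subset\widetilde H$ and $f'(x)=h\,g'(x)\,h^{-1}$ for all $x\in G$. (5) There is an obstruction map $\mathrm{Obs}:[LH]^\theta\mathrm{mo}(G,N)_\rho\to H^2(G,L;(A,\rho))$, $\mathrm{Obs}([f])=[f^\sharp]$, where the cocycle $f^\sharp$ is defined by $f^\sharp(x,y)=f(x)f(y)f(xy)^{-1}\widetilde H$. (6) The sequence $$H^1(G,L;A)\dashrightarrow[L\widetilde H]^\theta\mathrm{mo}(G,N)\longrightarrow[LH]^\theta\mathrm{mo}(G,N)\longrightarrow H^2(G,L;A)$$ (in which the second and third terms are sets, not even pointed sets, and the first arrow is an "action" rather than a map) is exact, i.e. the image of $\mathrm{Res}$ is equal to $\mathrm{Obs}^{-1}([0])$.
   Context: For group–subgroup pairs $G\ge L$, $K\ge H$, a weak $(L,H)$-morph from $G$ to $K$ is a function $f:G\to K$ such that (i) $f|_L$ is a group homomorphism, (ii) $f(G)\subset N_K(H)$, (iii) $f(x)f(y)\in f(xy)H$ for all $x,y\in G$. Two weak $(L,H)$-morphs $f,f'$ are equivalent if $f'(x)\in f(x)H$ for all $x\in G$. For a fixed homomorphism $\theta:L\to K$, $[LH]^\theta\mathrm{mo}(G,K)$ denotes the set of equivalence classes of those weak $(L,H)$-morphs that restrict to $\theta$ on $L$. The set $[L\widetilde H]^\theta\mathrm{mo}(G,N)$ is defined in the same way with $\widetilde H$ in place of $H$ and $N$ in place of $K$. In the setting of the claim, conjugation ${}^{gH}(h\widetilde H)=ghg^{-1}\widetilde H$ defines a structure of an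 $N/H$-module on $A=H/\widetilde H$, and, via any weak $(L,H)$-morph, a $G$-module structure on $A$. For each particular $G$-module structure $\rho$ on $A$ (not just its isomorphism class), the subscript $\rho$ in $[L\widetilde H]^\theta\mathrm{mo}(G,N)_\rho$ and $[LH]^\theta\mathrm{mo}(G,N)_\rho$ denotes the subset of those weak morphs that define this particular action $\rho$. These subsets could be empty, in which case the theorem is considered true for trivial reasons. Relative cohomology: for a $\mathbb ZG$-module $A$, let $(C^\bullet(G;A),d)$ be the standard cochain complex of group cohomology. The subcomplex $C^\bullet(G,L;A)$ has $C^0(G,L;A)=A^L$ and, for $n>0$, $C^n(G,L;A)=\{\mu\in C^n(G;A):\mu|_{L^n}\equiv0\}$. Its cocycles, coboundaries and cohomology are denoted $Z^n(G,L;A)$, $B^n(G,L;A)$, $H^n(G,L;A)$; writing $(A,\rho)$ indicates the action used. *)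

theory Defs
  imports "HOL-Algebra.Algebra"
begin

section \<open>Weak morphs\<close>

text \<open>
  Maps defined on a carrier are taken to be extensional, so that equality of maps is
  equality on the carrier.
\<close>

definition weak_morphs ::
  "('a, 'm) monoid_scheme \<Rightarrow> 'a set \<Rightarrow> ('b, 'n) monoid_scheme \<Rightarrow> 'b set \<Rightarrow> ('a \<Rightarrow> 'b) set"
  where "weak_morphs G L K H =
    {f \<in> carrier G \<rightarrow>\<^sub>E carrier K.
       f \<in> hom (G\<lparr>carrier := L\<rparr>) K
     \<and> f ` carrier G \<subseteq> normalizer K H
     \<and> (\<forall>x \<in> carrier G. \<forall>y \<in> carrier G.
          f x \<otimes>\<^bsub>K\<^esub> f y \<in> f (x \<otimes>\<^bsub>G\<^esub> y) <#\<^bsub>K\<^esub> H)}"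

definition weak_equiv ::
  "('a, 'm) monoid_scheme \<Rightarrow> 'a set \<Rightarrow> ('b, 'n) monoid_scheme \<Rightarrow> 'b set
    \<Rightarrow> (('a \<Rightarrow> 'b) \<times> ('a \<Rightarrow> 'b)) set"
  where "weak_equiv G L K H =
    {(f, f'). f \<in> weak_morphs G L K H \<and> f' \<in> weak_morphs G L K H
       \<and> (\<forall>x \<in> carrier G. f' x \<in> f x <#\<^bsub>K\<^esub> H)}"

text \<open>
  The class of \<open>f\<close> consists of all weak \<open>(L, H)\<close>-morphs equivalent to \<open>f\<close>. If \<open>f\<close> restricts
  to a homomorphism \<open>\<theta>\<close> on \<open>L\<close>, then other members of its class need to agree with \<open>\<theta>\<close> only
  modulo \<open>H\<close>.
\<close>

definition weak_class ::
  "('a, 'm) monoid_scheme \<Rightarrow> 'a set \<Rightarrow> ('b, 'n) monoid_scheme \<Rightarrow> 'b set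
    \<Rightarrow> ('a \<Rightarrow> 'b) \<Rightarrow> ('a \<Rightarrow> 'b) set"
  where "weak_class G L K H f = weak_equiv G L K H `` {f}"

definition weak_morphs_rest ::
  "('a, 'm) monoid_scheme \<Rightarrow> 'a set \<Rightarrow> ('b, 'n) monoid_scheme \<Rightarrow> 'b set \<Rightarrow> ('a \<Rightarrow> 'b)
    \<Rightarrow> ('a \<Rightarrow> 'b) set"
  where "weak_morphs_rest G L K H \<theta> = {f \<in> weak_morphs G L K H. \<forall>l \<in> L. f l = \<theta> l}"

text \<open>\<open>f\<close> defines the action \<open>\<rho>\<close> of \<open>G\<close> on \<open>H / Ht\<close> by conjugation in \<open>K\<close>.\<close>

definition defines_action ::
  "('a, 'm) monoid_scheme \<Rightarrow> ('b, 'n) monoid_scheme \<Rightarrow> 'b set \<Rightarrow> 'b set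
    \<Rightarrow> ('a \<Rightarrow> 'b set \<Rightarrow> 'b set) \<Rightarrow> ('a \<Rightarrow> 'b) \<Rightarrow> bool"
  where "defines_action G K H Ht \<rho> f \<longleftrightarrow>
    (\<forall>x \<in> carrier G. \<forall>h \<in> H.
       \<rho> x (h <#\<^bsub>K\<^esub> Ht) = (f x \<otimes>\<^bsub>K\<^esub> h \<otimes>\<^bsub>K\<^esub> inv\<^bsub>K\<^esub> f x) <#\<^bsub>K\<^esub> Ht)"


section \<open>Relative group cohomology\<close>

text \<open>
  Inhomogeneous cochains; an \<open>n\<close>-tuple is a list of length \<open>n\<close>. The coefficient module is
  a commutative group \<open>A\<close>, written multiplicatively, with an action
  \<open>\<rho> \<in> hom G (AutoGroup A)\<close>.
\<close>

definition tuples :: "'a set \<Rightarrow> nat \<Rightarrow> 'a list set"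
  where "tuples S n = {xs. length xs = n \<and> set xs \<subseteq> S}"

definition cochain_group ::
  "('a, 'm) monoid_scheme \<Rightarrow> ('c, 'k) monoid_scheme \<Rightarrow> nat \<Rightarrow> ('a list \<Rightarrow> 'c) monoid"
  where "cochain_group G A n =
    \<lparr>carrier = tuples (carrier G) n \<rightarrow>\<^sub>E carrier A,
     monoid.mult = (\<lambda>\<mu> \<nu>. \<lambda>xs \<in> tuples (carrier G) n. \<mu> xs \<otimes>\<^bsub>A\<^esub> \<nu> xs),
     one = (\<lambda>xs \<in> tuples (carrier G) n. \<one>\<^bsub>A\<^esub>)\<rparr>"

text \<open>
  \<open>merge_at G i [x\<^sub>0, \<dots>, x\<^sub>n]\<close> replaces the adjacent entries \<open>x\<^sub>i, x\<^sub>i\<^sub>+\<^sub>1\<close> by their product.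
\<close>

definition merge_at :: "('a, 'm) monoid_scheme \<Rightarrow> nat \<Rightarrow> 'a list \<Rightarrow> 'a list"
  where "merge_at G i xs =
    take i xs @ (xs ! i \<otimes>\<^bsub>G\<^esub> xs ! Suc i) # drop (Suc (Suc i)) xs"

definition cochain_diff ::
  "('a, 'm) monoid_scheme \<Rightarrow> ('c, 'k) monoid_scheme \<Rightarrow> ('a \<Rightarrow> 'c \<Rightarrow> 'c) \<Rightarrow> nat
    \<Rightarrow> ('a list \<Rightarrow> 'c) \<Rightarrow> 'a list \<Rightarrow> 'c"
  where "cochain_diff G A \<rho> n \<mu> =
    (\<lambda>xs \<in> tuples (carrier G) (Suc n).
       \<rho> (hd xs) (\<mu> (tl xs))
       \<otimes>\<^bsub>A\<^esub> (\<Otimes>\<^bsub>A\<^esub>i \<in> {..<n}. \<mu> (merge_at G i xs) [^]\<^bsub>A\<^esub> ((-1::int) ^ Suc i))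
       \<otimes>\<^bsub>A\<^esub> \<mu> (butlast xs) [^]\<^bsub>A\<^esub> ((-1::int) ^ Suc n))"

definition rel_cochains ::
  "('a, 'm) monoid_scheme \<Rightarrow> 'a set \<Rightarrow> ('c, 'k) monoid_scheme \<Rightarrow> ('a \<Rightarrow> 'c \<Rightarrow> 'c) \<Rightarrow> nat
    \<Rightarrow> ('a list \<Rightarrow> 'c) set"
  where "rel_cochains G L A \<rho> n =
    {\<mu> \<in> carrier (cochain_group G A n).
       if n = 0 then \<forall>l \<in> L. \<rho> l (\<mu> []) = \<mu> []
       else \<forall>xs \<in> tuples L n. \<mu> xs = \<one>\<^bsub>A\<^esub>}"

definition rel_cocycles ::
  "('a, 'm) monoid_scheme \<Rightarrow> 'a set \<Rightarrow> ('c, 'k) monoid_scheme \<Rightarrow> ('a \<Rightarrow> 'c \<Rightarrow> 'c) \<Rightarrow> nat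
    \<Rightarrow> ('a list \<Rightarrow> 'c) set"
  where "rel_cocycles G L A \<rho> n =
    {\<mu> \<in> rel_cochains G L A \<rho> n.
       cochain_diff G A \<rho> n \<mu> = \<one>\<^bsub>cochain_group G A (Suc n)\<^esub>}"

definition rel_coboundaries ::
  "('a, 'm) monoid_scheme \<Rightarrow> 'a set \<Rightarrow> ('c, 'k) monoid_scheme \<Rightarrow> ('a \<Rightarrow> 'c \<Rightarrow> 'c) \<Rightarrow> nat
    \<Rightarrow> ('a list \<Rightarrow> 'c) set"
  where "rel_coboundaries G L A \<rho> n =
    (case n of
       0 \<Rightarrow> {\<one>\<^bsub>cochain_group G A 0\<^esub>}
     | Suc m \<Rightarrow> cochain_diff G A \<rho> m ` rel_cochains G L A \<rho> m)"

definition rel_Z ::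
  "('a, 'm) monoid_scheme \<Rightarrow> 'a set \<Rightarrow> ('c, 'k) monoid_scheme \<Rightarrow> ('a \<Rightarrow> 'c \<Rightarrow> 'c) \<Rightarrow> nat
    \<Rightarrow> ('a list \<Rightarrow> 'c) monoid"
  where "rel_Z G L A \<rho> n = (cochain_group G A n)\<lparr>carrier := rel_cocycles G L A \<rho> n\<rparr>"

definition rel_B ::
  "('a, 'm) monoid_scheme \<Rightarrow> 'a set \<Rightarrow> ('c, 'k) monoid_scheme \<Rightarrow> ('a \<Rightarrow> 'c \<Rightarrow> 'c) \<Rightarrow> nat
    \<Rightarrow> ('a list \<Rightarrow> 'c) monoid"
  where "rel_B G L A \<rho> n = (cochain_group G A n)\<lparr>carrier := rel_coboundaries G L A \<rho> n\<rparr>"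

definition rel_H ::
  "('a, 'm) monoid_scheme \<Rightarrow> 'a set \<Rightarrow> ('c, 'k) monoid_scheme \<Rightarrow> ('a \<Rightarrow> 'c \<Rightarrow> 'c) \<Rightarrow> nat
    \<Rightarrow> ('a list \<Rightarrow> 'c) set monoid"
  where "rel_H G L A \<rho> n = rel_Z G L A \<rho> n Mod rel_coboundaries G L A \<rho> n"

definition rel_H_class ::
  "('a, 'm) monoid_scheme \<Rightarrow> 'a set \<Rightarrow> ('c, 'k) monoid_scheme \<Rightarrow> ('a \<Rightarrow> 'c \<Rightarrow> 'c) \<Rightarrow> nat
    \<Rightarrow> ('a list \<Rightarrow> 'c) \<Rightarrow> ('a list \<Rightarrow> 'c) set"
  where "rel_H_class G L A \<rho> n \<mu> =
    rel_coboundaries G L A \<rho> n #>\<^bsub>rel_Z G L A \<rho> n\<^esub> \<mu>"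


section \<open>Actions, lifts and the obstruction cocycle\<close>

definition free_action ::
  "('z, 'm) monoid_scheme \<Rightarrow> 'e set \<Rightarrow> ('z \<Rightarrow> 'e \<Rightarrow> 'e) \<Rightarrow> bool"
  where "free_action Z E act \<longleftrightarrow>
    group_action Z E act \<and> (\<forall>e \<in> E. stabilizer Z act e = {\<one>\<^bsub>Z\<^esub>})"

definition quotient_map_by_action ::
  "('z, 'm) monoid_scheme \<Rightarrow> ('z \<Rightarrow> 'e \<Rightarrow> 'e) \<Rightarrow> 'e set \<Rightarrow> 'i set \<Rightarrow> ('e \<Rightarrow> 'i) \<Rightarrow> bool"
  where "quotient_map_by_action Z act E I q \<longleftrightarrow>
    q ` E = I \<and> (\<forall>c \<in> E. \<forall>c' \<in> E. q c = q c' \<longleftrightarrow> c' \<in> orbit Z act c)"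

text \<open>
  A lift of a 1-cochain \<open>\<gamma>\<close> with values in \<open>H / Ht\<close> is a composite of \<open>\<gamma>\<close> with a set-theoretic
  section \<open>s\<close> of \<open>H \<rightarrow> H / Ht\<close>. Being a composite with a section, a lift of a relative cocycle
  that takes the value 1 at 1 is identically 1 on \<open>L\<close>.
\<close>

definition is_lift ::
  "('a, 'm) monoid_scheme \<Rightarrow> ('b, 'n) monoid_scheme \<Rightarrow> 'b set \<Rightarrow> 'b set
    \<Rightarrow> ('a list \<Rightarrow> 'b set) \<Rightarrow> ('a \<Rightarrow> 'b) \<Rightarrow> bool"
  where "is_lift G K H Ht \<gamma> \<gamma>d \<longleftrightarrow>
    (\<exists>s \<in> carrier (K\<lparr>carrier := H\<rparr> Mod Ht) \<rightarrow> H.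
       (\<forall>a \<in> carrier (K\<lparr>carrier := H\<rparr> Mod Ht). s a <#\<^bsub>K\<^esub> Ht = a)
     \<and> (\<forall>x \<in> carrier G. \<gamma>d x = s (\<gamma> [x]))
     \<and> \<gamma>d \<one>\<^bsub>G\<^esub> = \<one>\<^bsub>K\<^esub>)"

definition mult_left ::
  "('a, 'm) monoid_scheme \<Rightarrow> ('b, 'n) monoid_scheme \<Rightarrow> ('a \<Rightarrow> 'b) \<Rightarrow> ('a \<Rightarrow> 'b) \<Rightarrow> 'a \<Rightarrow> 'b"
  where "mult_left G K \<gamma>d f = (\<lambda>x \<in> carrier G. \<gamma>d x \<otimes>\<^bsub>K\<^esub> f x)"

definition sharp ::
  "('a, 'm) monoid_scheme \<Rightarrow> ('b, 'n) monoid_scheme \<Rightarrow> 'b set \<Rightarrow> ('a \<Rightarrow> 'b) \<Rightarrow> 'a list \<Rightarrow> 'b set"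
  where "sharp G K Ht f =
    (\<lambda>xs \<in> tuples (carrier G) 2.
       (f (xs ! 0) \<otimes>\<^bsub>K\<^esub> f (xs ! 1) \<otimes>\<^bsub>K\<^esub> inv\<^bsub>K\<^esub> f (xs ! 0 \<otimes>\<^bsub>G\<^esub> xs ! 1)) <#\<^bsub>K\<^esub> Ht)"

end

theory Submission
  imports Defs
begin

text \<open>
  Write \<open>Q\<close> for the group \<open>N / Ht\<close> and \<open>\<pi>\<close> for the projection \<open>N \<rightarrow> Q\<close>. Then \<open>A = H / Ht\<close> is an
  abelian subgroup of \<open>Q\<close>, and everything is read off from the maps \<open>F = \<pi> \<circ> f : G \<rightarrow> Q\<close>. A weak
  \<open>(L, Ht)\<close>-morph is a map \<open>f\<close>, homomorphic on \<open>L\<close>, for which \<open>F\<close> is a homomorphism, and its class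
  is determined by \<open>F\<close>. A weak \<open>(L, H)\<close>-morph is one for which the defect
  \<open>F x F y F(x y)\<^sup>-\<^sup>1\<close> has values in \<open>A\<close>, and its class is determined by \<open>F\<close> modulo left
  multiplication by functions \<open>c : G \<rightarrow> A\<close>. This defect is the obstruction cocycle \<open>f\<^sup>\<sharp>\<close>.

  One computation carries the theorem (\<open>defect_twist\<close>): if \<open>F\<close> induces the action \<open>\<rho>\<close> on \<open>A\<close>, then
  replacing \<open>F\<close> by \<open>c F\<close> multiplies its defect by the coboundary \<open>d c\<close>. As all maps considered
  restrict to \<open>\<theta>\<close> on \<open>L\<close>, the functions \<open>c\<close> that compare them are trivial on \<open>L\<close>, so relative
  cochains are the right ones. Consequently:
  \<^item> \<open>c F\<close> is a homomorphism together with \<open>F\<close> precisely when \<open>c\<close> is a relative 1-cocycle; so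
    the cocycles act on the classes of weak \<open>(L, Ht)\<close>-morphs, freely by cancellation in \<open>Q\<close>,
    and the orbits are the fibres of the restriction map
    (\<open>free_action_translation\<close>, \<open>quotient_map_restriction\<close>).
  \<^item> If \<open>c\<close> is the coboundary of \<open>a \<in> A\<close>, then \<open>c F\<close> is \<open>F\<close> conjugated by \<open>a\<^sup>-\<^sup>1\<close>, because
    \<open>F x a (F x)\<^sup>-\<^sup>1\<close> and \<open>a\<close> commute; invariance of \<open>a\<close> under \<open>L\<close> is the commutator condition
    (\<open>twist_coboundary\<close>, \<open>coboundary_orbit\<close>).
  \<^item> The cohomology class of the defect depends on the class of \<open>f\<close> modulo \<open>H\<close> only, and if the
    defect is a coboundary \<open>d b\<close>, then \<open>b\<^sup>-\<^sup>1 F\<close> is a homomorphism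
    (\<open>obstruction_class\<close>, \<open>exactness\<close>).

  To return from \<open>Q\<close> to \<open>N\<close>, values of \<open>c\<close> are lifted through a section of \<open>H \<rightarrow> A\<close> that sends 1
  to 1. The lift is then identically 1 on \<open>L\<close>, which keeps the restriction to \<open>\<theta>\<close> intact
  (\<open>mult_left_lift\<close>).
\<close>

section \<open>Relative cochains\<close>

lemma tuples_0 [simp]: "xs \<in> tuples S 0 \<longleftrightarrow> xs = []"
  by (auto simp: tuples_def)

lemma tuples_1: "xs \<in> tuples S (Suc 0) \<longleftrightarrow> (\<exists>x\<in>S. xs = [x])"
  by (auto simp: tuples_def length_Suc_conv)

lemma tuples_2: "xs \<in> tuples S 2 \<longleftrightarrow> (\<exists>x\<in>S. \<exists>y\<in>S. xs = [x, y])"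
  by (auto simp: tuples_def numeral_2_eq_2 length_Suc_conv)

lemma tuples_3: "xs \<in> tuples S 3 \<longleftrightarrow> (\<exists>x\<in>S. \<exists>y\<in>S. \<exists>z\<in>S. xs = [x, y, z])"
  by (auto simp: tuples_def numeral_3_eq_3 length_Suc_conv)

lemma tuples_mono: "S \<subseteq> T \<Longrightarrow> tuples S n \<subseteq> tuples T n"
  by (auto simp: tuples_def)

lemma Cons_tuples_1 [simp]: "[x] \<in> tuples S (Suc 0) \<longleftrightarrow> x \<in> S"
  by (auto simp: tuples_def)

lemma Cons_tuples_2 [simp]: "[x, y] \<in> tuples S 2 \<longleftrightarrow> x \<in> S \<and> y \<in> S"
  by (auto simp: tuples_2)

lemma Cons_tuples_3 [simp]: "[x, y, z] \<in> tuples S 3 \<longleftrightarrow> x \<in> S \<and> y \<in> S \<and> z \<in> S"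
  by (auto simp: tuples_3)

lemma tuples_faces:
  assumes "xs \<in> tuples S (Suc n)"
  shows "hd xs \<in> S" "tl xs \<in> tuples S n" "butlast xs \<in> tuples S n"
  using assms by (cases xs; auto simp: tuples_def dest: in_set_butlastD)+

lemma (in monoid) merge_at_tuples:
  assumes xs: "xs \<in> tuples (carrier G) (Suc n)" and i: "i < n"
  shows "merge_at G i xs \<in> tuples (carrier G) n"
proof -
  have len: "length xs = Suc n" and mem: "set xs \<subseteq> carrier G"
    using xs by (auto simp: tuples_def)
  have "xs ! i \<in> carrier G" "xs ! Suc i \<in> carrier G"
    using len mem i by (auto simp: subset_iff)
  moreover have "set (take i xs) \<subseteq> carrier G" "set (drop (Suc (Suc i)) xs) \<subseteq> carrier G"
    using mem set_take_subset set_drop_subset by (metis subset_trans)+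
  ultimately show ?thesis
    using len i by (auto simp: merge_at_def tuples_def)
qed

locale relative_module = G: group G + A: comm_group A
  for G :: "('a, 'm) monoid_scheme" and A :: "('c, 'k) monoid_scheme" +
  fixes L :: "'a set" and \<rho> :: "'a \<Rightarrow> 'c \<Rightarrow> 'c"
  assumes L_subgroup: "subgroup L G"
    and action_hom: "\<rho> \<in> hom G (AutoGroup A)"
begin

abbreviation C :: "nat \<Rightarrow> ('a list \<Rightarrow> 'c) monoid"
  where "C n \<equiv> cochain_group G A n"

abbreviation d :: "nat \<Rightarrow> ('a list \<Rightarrow> 'c) \<Rightarrow> 'a list \<Rightarrow> 'c"
  where "d \<equiv> cochain_diff G A \<rho>"

lemma L_subset: "x \<in> L \<Longrightarrow> x \<in> carrier G"
  using L_subgroup by (rule subgroup.mem_carrier)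

lemma one_in_L: "\<one>\<^bsub>G\<^esub> \<in> L"
  using L_subgroup by (rule subgroup.one_closed)

lemma act_auto: "x \<in> carrier G \<Longrightarrow> \<rho> x \<in> auto A"
  using action_hom by (auto simp: hom_def AutoGroup_def)

lemma act_hom: "x \<in> carrier G \<Longrightarrow> group_hom A A (\<rho> x)"
  using act_auto by unfold_locales (auto simp: auto_def)

lemma act_closed [simp, intro]:
  "x \<in> carrier G \<Longrightarrow> a \<in> carrier A \<Longrightarrow> \<rho> x a \<in> carrier A"
  using act_hom group_hom.hom_closed by metis

lemma act_mult:
  "x \<in> carrier G \<Longrightarrow> a \<in> carrier A \<Longrightarrow> b \<in> carrier A \<Longrightarrow>
    \<rho> x (a \<otimes>\<^bsub>A\<^esub> b) = \<rho> x a \<otimes>\<^bsub>A\<^esub> \<rho> x b"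
  using act_hom group_hom.hom_mult by metis

lemma act_one [simp]: "x \<in> carrier G \<Longrightarrow> \<rho> x \<one>\<^bsub>A\<^esub> = \<one>\<^bsub>A\<^esub>"
  using act_hom group_hom.hom_one by metis

lemma act_inv:
  "x \<in> carrier G \<Longrightarrow> a \<in> carrier A \<Longrightarrow> \<rho> x (inv\<^bsub>A\<^esub> a) = inv\<^bsub>A\<^esub> \<rho> x a"
  using act_hom group_hom.hom_inv by metis

lemma act_act:
  assumes "x \<in> carrier G" "y \<in> carrier G" "a \<in> carrier A"
  shows "\<rho> (x \<otimes>\<^bsub>G\<^esub> y) a = \<rho> x (\<rho> y a)"
proof -
  have "\<rho> (x \<otimes>\<^bsub>G\<^esub> y) = \<rho> x \<otimes>\<^bsub>BijGroup (carrier A)\<^esub> \<rho> y"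
    using action_hom assms by (auto simp: hom_def AutoGroup_def)
  also have "\<dots> = compose (carrier A) (\<rho> x) (\<rho> y)"
    using act_auto assms by (auto simp: BijGroup_def auto_def)
  finally show ?thesis
    using assms by (simp add: compose_eq)
qed

lemma carrier_C: "carrier (C n) = tuples (carrier G) n \<rightarrow>\<^sub>E carrier A"
  by (simp add: cochain_group_def)

lemma one_C: "\<one>\<^bsub>C n\<^esub> = (\<lambda>xs \<in> tuples (carrier G) n. \<one>\<^bsub>A\<^esub>)"
  by (simp add: cochain_group_def)

lemma mult_C: "\<mu> \<otimes>\<^bsub>C n\<^esub> \<nu> = (\<lambda>xs \<in> tuples (carrier G) n. \<mu> xs \<otimes>\<^bsub>A\<^esub> \<nu> xs)"
  by (simp add: cochain_group_def)

lemma C_closed: "\<mu> \<in> carrier (C n) \<Longrightarrow> xs \<in> tuples (carrier G) n \<Longrightarrow> \<mu> xs \<in> carrier A"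
  by (auto simp: carrier_C)

lemma C_eqI:
  assumes "\<mu> \<in> carrier (C n)" "\<nu> \<in> carrier (C n)"
    and "\<And>xs. xs \<in> tuples (carrier G) n \<Longrightarrow> \<mu> xs = \<nu> xs"
  shows "\<mu> = \<nu>"
  using assms unfolding carrier_C by (rule PiE_ext)

lemma comm_group_C: "comm_group (C n)"
proof (rule comm_groupI)
  fix \<mu> assume \<mu>: "\<mu> \<in> carrier (C n)"
  have "(\<lambda>xs \<in> tuples (carrier G) n. inv\<^bsub>A\<^esub> \<mu> xs) \<in> carrier (C n)"
    using \<mu> by (auto simp: carrier_C)
  moreover have "(\<lambda>xs \<in> tuples (carrier G) n. inv\<^bsub>A\<^esub> \<mu> xs) \<otimes>\<^bsub>C n\<^esub> \<mu> = \<one>\<^bsub>C n\<^esub>"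
    using C_closed[OF \<mu>] by (auto simp: mult_C one_C fun_eq_iff)
  ultimately show "\<exists>\<nu>\<in>carrier (C n). \<nu> \<otimes>\<^bsub>C n\<^esub> \<mu> = \<one>\<^bsub>C n\<^esub>" by blast
next
  fix \<mu> assume \<mu>: "\<mu> \<in> carrier (C n)"
  then show "\<one>\<^bsub>C n\<^esub> \<otimes>\<^bsub>C n\<^esub> \<mu> = \<mu>"
    using C_closed[OF \<mu>] by (intro C_eqI) (auto simp: carrier_C mult_C one_C)
qed (auto simp: carrier_C mult_C one_C fun_eq_iff PiE_iff A.m_ac)

sublocale C: comm_group "C n" for n
  by (rule comm_group_C)

lemma inv_C: "\<mu> \<in> carrier (C n) \<Longrightarrow> xs \<in> tuples (carrier G) n \<Longrightarrow>
    (inv\<^bsub>C n\<^esub> \<mu>) xs = inv\<^bsub>A\<^esub> \<mu> xs"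
proof -
  assume \<mu>: "\<mu> \<in> carrier (C n)" and xs: "xs \<in> tuples (carrier G) n"
  have "(inv\<^bsub>C n\<^esub> \<mu> \<otimes>\<^bsub>C n\<^esub> \<mu>) xs = \<one>\<^bsub>A\<^esub>"
    using \<mu> xs by (simp add: one_C)
  then have "(inv\<^bsub>C n\<^esub> \<mu>) xs \<otimes>\<^bsub>A\<^esub> \<mu> xs = \<one>\<^bsub>A\<^esub>"
    using xs by (simp add: mult_C)
  then show ?thesis
    using A.inv_equality C_closed[OF \<mu> xs] C_closed[OF C.inv_closed[OF \<mu>] xs] by metis
qed

text \<open>
  Each face of a tuple contributes a homomorphism, since \<open>\<rho>\<close> acts by automorphisms and powers are
  multiplicative in a commutative group.
\<close>

lemma diff_hom: "d n \<in> hom (C n) (C (Suc n))"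
proof (rule homI)
  fix \<mu> assume \<mu>: "\<mu> \<in> carrier (C n)"
  show "d n \<mu> \<in> carrier (C (Suc n))"
    unfolding carrier_C cochain_diff_def
    by (auto intro!: A.m_closed A.finprod_closed A.int_pow_closed act_closed C_closed[OF \<mu>]
        tuples_faces G.merge_at_tuples)
next
  fix \<mu> \<nu> assume \<mu>: "\<mu> \<in> carrier (C n)" and \<nu>: "\<nu> \<in> carrier (C n)"
  show "d n (\<mu> \<otimes>\<^bsub>C n\<^esub> \<nu>) = d n \<mu> \<otimes>\<^bsub>C (Suc n)\<^esub> d n \<nu>"
  proof (rule ext)
    fix xs
    show "d n (\<mu> \<otimes>\<^bsub>C n\<^esub> \<nu>) xs = (d n \<mu> \<otimes>\<^bsub>C (Suc n)\<^esub> d n \<nu>) xs"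
    proof (cases "xs \<in> tuples (carrier G) (Suc n)")
      case True
      note faces = tuples_faces[OF True] G.merge_at_tuples[OF True]
      have "(\<Otimes>\<^bsub>A\<^esub>i \<in> {..<n}. (\<mu> \<otimes>\<^bsub>C n\<^esub> \<nu>) (merge_at G i xs) [^]\<^bsub>A\<^esub> ((-1::int) ^ Suc i))
        = (\<Otimes>\<^bsub>A\<^esub>i \<in> {..<n}. \<mu> (merge_at G i xs) [^]\<^bsub>A\<^esub> ((-1::int) ^ Suc i)
            \<otimes>\<^bsub>A\<^esub> \<nu> (merge_at G i xs) [^]\<^bsub>A\<^esub> ((-1::int) ^ Suc i))"
        by (rule A.finprod_cong')
          (auto simp: mult_C faces A.int_pow_distrib C_closed[OF \<mu>] C_closed[OF \<nu>])
      also have "\<dots> = (\<Otimes>\<^bsub>A\<^esub>i \<in> {..<n}. \<mu> (merge_at G i xs) [^]\<^bsub>A\<^esub> ((-1::int) ^ Suc i))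
            \<otimes>\<^bsub>A\<^esub> (\<Otimes>\<^bsub>A\<^esub>i \<in> {..<n}. \<nu> (merge_at G i xs) [^]\<^bsub>A\<^esub> ((-1::int) ^ Suc i))"
        by (rule A.finprod_multf) (auto simp: faces C_closed[OF \<mu>] C_closed[OF \<nu>])
      finally show ?thesis
        using True
        by (simp add: cochain_diff_def mult_C faces act_mult A.int_pow_distrib A.m_ac
            C_closed[OF \<mu>] C_closed[OF \<nu>] A.finprod_closed Pi_iff)
    qed (simp add: cochain_diff_def mult_C)
  qed
qed

sublocale d: group_hom "C n" "C (Suc n)" "d n" for n
  by unfold_locales (rule diff_hom)

lemma rel_cochains_subgroup: "subgroup (rel_cochains G L A \<rho> n) (C n)"
proof -
  have L: "xs \<in> tuples L n \<Longrightarrow> xs \<in> tuples (carrier G) n" for xs n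
    using tuples_mono[of L "carrier G"] L_subset by blast
  show ?thesis
  proof (rule C.subgroupI)
    have "\<one>\<^bsub>C n\<^esub> \<in> rel_cochains G L A \<rho> n"
      using C.one_closed[of n] L_subset by (auto simp: rel_cochains_def one_C L)
    then show "rel_cochains G L A \<rho> n \<noteq> {}" by blast
  next
    fix \<mu> assume "\<mu> \<in> rel_cochains G L A \<rho> n"
    then show "inv\<^bsub>C n\<^esub> \<mu> \<in> rel_cochains G L A \<rho> n"
      by (auto simp: rel_cochains_def inv_C L act_inv L_subset C_closed split: if_splits)
  next
    fix \<mu> \<nu> assume "\<mu> \<in> rel_cochains G L A \<rho> n" "\<nu> \<in> rel_cochains G L A \<rho> n"
    then show "\<mu> \<otimes>\<^bsub>C n\<^esub> \<nu> \<in> rel_cochains G L A \<rho> n"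
      using C.m_closed[of \<mu> n \<nu>]
      by (auto simp: rel_cochains_def mult_C L act_mult L_subset C_closed split: if_splits)
  qed (auto simp: rel_cochains_def)
qed

lemma rel_cochains_1_iff:
  "c \<in> rel_cochains G L A \<rho> 1 \<longleftrightarrow> c \<in> carrier (C 1) \<and> (\<forall>l\<in>L. c [l] = \<one>\<^bsub>A\<^esub>)"
  by (auto simp: rel_cochains_def tuples_1)

lemma rel_cochains_2_iff:
  "c \<in> rel_cochains G L A \<rho> 2 \<longleftrightarrow>
    c \<in> carrier (C 2) \<and> (\<forall>l\<in>L. \<forall>m\<in>L. c [l, m] = \<one>\<^bsub>A\<^esub>)"
  by (auto simp: rel_cochains_def tuples_2)

lemma rel_cocycles_subgroup: "subgroup (rel_cocycles G L A \<rho> n) (C n)"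
proof -
  have "rel_cocycles G L A \<rho> n = rel_cochains G L A \<rho> n \<inter> kernel (C n) (C (Suc n)) (d n)"
    by (auto simp: rel_cocycles_def kernel_def rel_cochains_def)
  then show ?thesis
    using C.subgroups_Inter_pair rel_cochains_subgroup d.subgroup_kernel by metis
qed

lemma rel_coboundaries_subgroup: "subgroup (rel_coboundaries G L A \<rho> n) (C n)"
proof (cases n)
  case 0
  then show ?thesis
    by (simp add: rel_coboundaries_def C.triv_subgroup)
next
  case (Suc m)
  then show ?thesis
    using d.subgroup_img_is_subgroup[OF rel_cochains_subgroup] by (simp add: rel_coboundaries_def)
qed

lemma comm_group_Z: "comm_group (rel_Z G L A \<rho> n)"
  unfolding rel_Z_def
  by (intro group.group_comm_groupI C.subgroup_imp_group rel_cocycles_subgroup)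
    (use subgroup.subset[OF rel_cocycles_subgroup] in \<open>auto intro: C.m_comm\<close>)

lemma carrier_Z: "carrier (rel_Z G L A \<rho> n) = rel_cocycles G L A \<rho> n"
  by (simp add: rel_Z_def)

lemma mult_Z: "\<gamma> \<otimes>\<^bsub>rel_Z G L A \<rho> n\<^esub> \<delta> = \<gamma> \<otimes>\<^bsub>C n\<^esub> \<delta>"
  by (simp add: rel_Z_def)

lemma one_Z: "\<one>\<^bsub>rel_Z G L A \<rho> n\<^esub> = \<one>\<^bsub>C n\<^esub>"
  by (simp add: rel_Z_def)

text \<open>
  Cosets only see the multiplication, which cocycles inherit from all cochains. So this is equality
  of cosets of the coboundaries in the group of cochains.
\<close>

lemma rel_H_class_eq_iff:
  assumes "\<mu> \<in> carrier (C n)" "\<nu> \<in> carrier (C n)"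
  shows "rel_H_class G L A \<rho> n \<mu> = rel_H_class G L A \<rho> n \<nu>
    \<longleftrightarrow> \<mu> \<otimes>\<^bsub>C n\<^esub> inv\<^bsub>C n\<^esub> \<nu> \<in> rel_coboundaries G L A \<rho> n"
proof -
  let ?B = "rel_coboundaries G L A \<rho> n"
  have cls: "rel_H_class G L A \<rho> n \<kappa> = ?B #>\<^bsub>C n\<^esub> \<kappa>" for \<kappa>
    by (simp add: rel_H_class_def rel_Z_def r_coset_def)
  show ?thesis
    unfolding cls
    by (metis C.is_group C.rcos_self C.repr_independence assms rel_coboundaries_subgroup
        subgroup.rcos_module)
qed

lemma rel_H_class_one:
  assumes "\<mu> \<in> carrier (C n)"
  shows "rel_H_class G L A \<rho> n \<mu> = \<one>\<^bsub>rel_H G L A \<rho> n\<^esub> \<longleftrightarrow> \<mu> \<in> rel_coboundaries G L A \<rho> n"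
proof -
  have "\<one>\<^bsub>rel_H G L A \<rho> n\<^esub> = rel_H_class G L A \<rho> n \<one>\<^bsub>C n\<^esub>"
    using C.coset_mult_one subgroup.subset[OF rel_coboundaries_subgroup]
    by (simp add: rel_H_def rel_H_class_def rel_Z_def r_coset_def)
  then show ?thesis
    using assms by (simp add: rel_H_class_eq_iff)
qed

lemma rel_H_class_closed:
  "\<mu> \<in> rel_cocycles G L A \<rho> n \<Longrightarrow> rel_H_class G L A \<rho> n \<mu> \<in> carrier (rel_H G L A \<rho> n)"
  by (auto simp: rel_H_class_def rel_H_def carrier_FactGroup rel_Z_def)

lemma diff_0:
  assumes "\<mu> \<in> carrier (C 0)" "x \<in> carrier G"
  shows "d 0 \<mu> [x] = \<rho> x (\<mu> []) \<otimes>\<^bsub>A\<^esub> inv\<^bsub>A\<^esub> \<mu> []"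
proof -
  have "\<mu> [] \<in> carrier A" using assms by (auto simp: C_closed)
  then show ?thesis using assms by (simp add: cochain_diff_def A.int_pow_neg)
qed

lemma diff_1:
  assumes "\<mu> \<in> carrier (C 1)" "x \<in> carrier G" "y \<in> carrier G"
  shows "d 1 \<mu> [x, y] = \<rho> x (\<mu> [y]) \<otimes>\<^bsub>A\<^esub> inv\<^bsub>A\<^esub> \<mu> [x \<otimes>\<^bsub>G\<^esub> y] \<otimes>\<^bsub>A\<^esub> \<mu> [x]"
proof -
  have "\<mu> [z] \<in> carrier A" if "z \<in> carrier G" for z using assms(1) that by (auto simp: C_closed)
  then show ?thesis
    using assms
    by (simp add: cochain_diff_def merge_at_def A.int_pow_neg lessThan_Suc numeral_2_eq_2[symmetric])
qed

lemma diff_2: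
  assumes "\<mu> \<in> carrier (C 2)" "x \<in> carrier G" "y \<in> carrier G" "z \<in> carrier G"
  shows "d 2 \<mu> [x, y, z] = \<rho> x (\<mu> [y, z])
    \<otimes>\<^bsub>A\<^esub> (inv\<^bsub>A\<^esub> \<mu> [x \<otimes>\<^bsub>G\<^esub> y, z] \<otimes>\<^bsub>A\<^esub> \<mu> [x, y \<otimes>\<^bsub>G\<^esub> z]) \<otimes>\<^bsub>A\<^esub> inv\<^bsub>A\<^esub> \<mu> [x, y]"
proof -
  have "\<mu> [u, v] \<in> carrier A" if "u \<in> carrier G" "v \<in> carrier G" for u v
    using assms(1) that by (auto simp: C_closed)
  moreover have "{..<2} = {0, Suc 0}" by auto
  ultimately show ?thesis
    using assms
    by (simp add: cochain_diff_def merge_at_def A.int_pow_neg numeral_3_eq_3[symmetric])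
qed

text \<open>
  Composing two differentials in degree 0 cancels by \<open>act_act\<close>; the coboundary of \<open>a\<close> is trivial
  on \<open>L\<close> because \<open>a\<close> is fixed by \<open>L\<close>.
\<close>

lemma rel_B1_subset_Z1: "rel_coboundaries G L A \<rho> 1 \<subseteq> rel_cocycles G L A \<rho> 1"
proof
  fix \<gamma> assume "\<gamma> \<in> rel_coboundaries G L A \<rho> 1"
  then obtain \<mu> where \<mu>: "\<mu> \<in> rel_cochains G L A \<rho> 0" and \<gamma>: "\<gamma> = d 0 \<mu>"
    by (auto simp: rel_coboundaries_def)
  have \<mu>C: "\<mu> \<in> carrier (C 0)" and inv: "\<And>l. l \<in> L \<Longrightarrow> \<rho> l (\<mu> []) = \<mu> []"
    using \<mu> by (auto simp: rel_cochains_def)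
  have a: "\<mu> [] \<in> carrier A" using \<mu>C by (auto simp: C_closed)
  have \<gamma>C: "\<gamma> \<in> carrier (C 1)" unfolding \<gamma> using d.hom_closed[OF \<mu>C] by simp
  have "d 1 \<gamma> = \<one>\<^bsub>C 2\<^esub>"
  proof (rule C_eqI)
    show "d 1 \<gamma> \<in> carrier (C 2)" using d.hom_closed[OF \<gamma>C] by (simp add: numeral_2_eq_2)
    fix xs assume "xs \<in> tuples (carrier G) 2"
    then obtain x y where xs: "xs = [x, y]" and xy: "x \<in> carrier G" "y \<in> carrier G"
      by (auto simp: tuples_2)
    have "\<rho> x (\<rho> y (\<mu> [])) \<otimes>\<^bsub>A\<^esub> inv\<^bsub>A\<^esub> \<rho> x (\<mu> []) \<otimes>\<^bsub>A\<^esub>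
        (inv\<^bsub>A\<^esub> \<rho> x (\<rho> y (\<mu> [])) \<otimes>\<^bsub>A\<^esub> \<mu> []) \<otimes>\<^bsub>A\<^esub> (\<rho> x (\<mu> []) \<otimes>\<^bsub>A\<^esub> inv\<^bsub>A\<^esub> \<mu> []) =
      (\<rho> x (\<rho> y (\<mu> [])) \<otimes>\<^bsub>A\<^esub> inv\<^bsub>A\<^esub> \<rho> x (\<rho> y (\<mu> []))) \<otimes>\<^bsub>A\<^esub>
      (\<rho> x (\<mu> []) \<otimes>\<^bsub>A\<^esub> inv\<^bsub>A\<^esub> \<rho> x (\<mu> [])) \<otimes>\<^bsub>A\<^esub> (\<mu> [] \<otimes>\<^bsub>A\<^esub> inv\<^bsub>A\<^esub> \<mu> [])"
      using a xy by (simp add: A.m_ac del: A.r_inv A.l_inv)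
    then show "d 1 \<gamma> xs = \<one>\<^bsub>C 2\<^esub> xs"
      unfolding xs diff_1[OF \<gamma>C xy] using xy a
      by (simp add: \<gamma> diff_0[OF \<mu>C] one_C act_mult act_inv act_act A.inv_mult)
  qed simp
  moreover have "\<forall>xs \<in> tuples L 1. \<gamma> xs = \<one>\<^bsub>A\<^esub>"
    using inv a by (auto simp: tuples_1 \<gamma> diff_0[OF \<mu>C] L_subset)
  ultimately show "\<gamma> \<in> rel_cocycles G L A \<rho> 1"
    using \<gamma>C by (simp add: rel_cocycles_def rel_cochains_def numeral_2_eq_2)
qed

end

section \<open>The multiplicative defect of a map into an extension of the module\<close>

text \<open>
  A non-abelian analogue of the differential on 1-cochains: it measures how far \<open>F\<close> is from
  being a homomorphism.
\<close>

definition defect ::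
  "('a, 'm) monoid_scheme \<Rightarrow> ('c, 'k) monoid_scheme \<Rightarrow> ('a \<Rightarrow> 'c) \<Rightarrow> 'a list \<Rightarrow> 'c"
  where "defect G Q F =
    (\<lambda>xs \<in> tuples (carrier G) 2.
      F (xs ! 0) \<otimes>\<^bsub>Q\<^esub> F (xs ! 1) \<otimes>\<^bsub>Q\<^esub> inv\<^bsub>Q\<^esub> F (xs ! 0 \<otimes>\<^bsub>G\<^esub> xs ! 1))"

text \<open>
  The ambient group \<open>Q\<close> carries both the values of maps \<open>F : G \<rightarrow> Q\<close> and the module \<open>A\<close>, so that the
  action on \<open>A\<close> can be compared with conjugation by \<open>F x\<close>.
\<close>

locale module_in_group = relative_module G A L \<rho> + Q: group Q
  for G :: "('a, 'm) monoid_scheme" and A Q :: "('c, 'k) monoid_scheme" and L \<rho> +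
  assumes A_subgroup: "subgroup (carrier A) Q"
    and A_eq: "A = Q\<lparr>carrier := carrier A\<rparr>"
begin

lemma A_subset [simp, intro]: "a \<in> carrier A \<Longrightarrow> a \<in> carrier Q"
  using A_subgroup by (rule subgroup.mem_carrier)

lemma mult_A: "a \<otimes>\<^bsub>A\<^esub> b = a \<otimes>\<^bsub>Q\<^esub> b"
  by (subst A_eq) simp

lemma one_A: "\<one>\<^bsub>A\<^esub> = \<one>\<^bsub>Q\<^esub>"
  by (subst A_eq) simp

lemma inv_A: "a \<in> carrier A \<Longrightarrow> inv\<^bsub>A\<^esub> a = inv\<^bsub>Q\<^esub> a"
  by (subst A_eq) (rule Q.m_inv_consistent[OF A_subgroup])

lemma A_comm: "a \<in> carrier A \<Longrightarrow> b \<in> carrier A \<Longrightarrow> a \<otimes>\<^bsub>Q\<^esub> b = b \<otimes>\<^bsub>Q\<^esub> a"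
  using A.m_comm by (simp add: mult_A)

lemma A_inv_closed: "a \<in> carrier A \<Longrightarrow> inv\<^bsub>Q\<^esub> a \<in> carrier A"
  using A.inv_closed by (simp flip: inv_A)

text \<open>
  The condition concerns conjugation on \<open>A\<close> alone: such a map may fail to be multiplicative, and
  its defect then centralizes \<open>A\<close>.
\<close>

definition acting_maps :: "('a \<Rightarrow> 'c) set"
  where "acting_maps = {F \<in> carrier G \<rightarrow> carrier Q.
    \<forall>x\<in>carrier G. \<forall>a\<in>carrier A. \<rho> x a = F x \<otimes>\<^bsub>Q\<^esub> a \<otimes>\<^bsub>Q\<^esub> inv\<^bsub>Q\<^esub> F x}"

abbreviation twist :: "('a list \<Rightarrow> 'c) \<Rightarrow> ('a \<Rightarrow> 'c) \<Rightarrow> 'a \<Rightarrow> 'c"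
  where "twist c F \<equiv> \<lambda>x. c [x] \<otimes>\<^bsub>Q\<^esub> F x"

lemma acting_closed: "F \<in> acting_maps \<Longrightarrow> x \<in> carrier G \<Longrightarrow> F x \<in> carrier Q"
  by (auto simp: acting_maps_def)

lemma acting_conj:
  "F \<in> acting_maps \<Longrightarrow> x \<in> carrier G \<Longrightarrow> a \<in> carrier A \<Longrightarrow>
    F x \<otimes>\<^bsub>Q\<^esub> a \<otimes>\<^bsub>Q\<^esub> inv\<^bsub>Q\<^esub> F x = \<rho> x a"
  by (auto simp: acting_maps_def)

lemma acting_swap:
  assumes "F \<in> acting_maps" "x \<in> carrier G" "a \<in> carrier A"
  shows "F x \<otimes>\<^bsub>Q\<^esub> a = \<rho> x a \<otimes>\<^bsub>Q\<^esub> F x"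
  using acting_closed[OF assms(1,2)] assms(3)
  by (simp add: acting_conj[OF assms, symmetric] Q.m_assoc)

lemma defect_pair:
  "x \<in> carrier G \<Longrightarrow> y \<in> carrier G \<Longrightarrow>
    defect G Q F [x, y] = F x \<otimes>\<^bsub>Q\<^esub> F y \<otimes>\<^bsub>Q\<^esub> inv\<^bsub>Q\<^esub> F (x \<otimes>\<^bsub>G\<^esub> y)"
  by (simp add: defect_def)

lemma defect_cong:
  assumes "\<And>x. x \<in> carrier G \<Longrightarrow> F x = F' x"
  shows "defect G Q F = defect G Q F'"
  unfolding defect_def by (rule restrict_ext) (auto simp: tuples_2 assms)

lemma defect_one_iff:
  assumes "F \<in> carrier G \<rightarrow> carrier Q"
  shows "defect G Q F = \<one>\<^bsub>C 2\<^esub> \<longleftrightarrow>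
    (\<forall>x\<in>carrier G. \<forall>y\<in>carrier G. F x \<otimes>\<^bsub>Q\<^esub> F y = F (x \<otimes>\<^bsub>G\<^esub> y))"
proof -
  have "defect G Q F = \<one>\<^bsub>C 2\<^esub> \<longleftrightarrow>
      (\<forall>x\<in>carrier G. \<forall>y\<in>carrier G. defect G Q F [x, y] = \<one>\<^bsub>Q\<^esub>)"
  proof
    assume "defect G Q F = \<one>\<^bsub>C 2\<^esub>"
    then show "\<forall>x\<in>carrier G. \<forall>y\<in>carrier G. defect G Q F [x, y] = \<one>\<^bsub>Q\<^esub>"
      by (simp add: one_C one_A)
  next
    assume "\<forall>x\<in>carrier G. \<forall>y\<in>carrier G. defect G Q F [x, y] = \<one>\<^bsub>Q\<^esub>"
    then have "defect G Q F xs = \<one>\<^bsub>Q\<^esub>" if "xs \<in> tuples (carrier G) 2" for xs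
      using that by (auto simp: tuples_2)
    then show "defect G Q F = \<one>\<^bsub>C 2\<^esub>"
      unfolding one_C one_A defect_def fun_eq_iff by simp
  qed
  also have "\<dots> \<longleftrightarrow> (\<forall>x\<in>carrier G. \<forall>y\<in>carrier G. F x \<otimes>\<^bsub>Q\<^esub> F y = F (x \<otimes>\<^bsub>G\<^esub> y))"
  proof (intro ball_cong refl)
    fix x y assume "x \<in> carrier G" "y \<in> carrier G"
    then show "defect G Q F [x, y] = \<one>\<^bsub>Q\<^esub> \<longleftrightarrow> F x \<otimes>\<^bsub>Q\<^esub> F y = F (x \<otimes>\<^bsub>G\<^esub> y)"
      using assms Q.inv_solve_right[of "\<one>\<^bsub>Q\<^esub>" "F x \<otimes>\<^bsub>Q\<^esub> F y" "F (x \<otimes>\<^bsub>G\<^esub> y)"]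
      by (auto simp: defect_pair Pi_iff)
  qed
  finally show ?thesis .
qed

text \<open>
  Moving the values of \<open>c\<close> to the left past \<open>F x\<close> costs exactly the action \<open>\<rho> x\<close>; as \<open>A\<close> is
  abelian, what remains is the coboundary of \<open>c\<close> times the old defect.
\<close>

lemma defect_twist:
  assumes F: "F \<in> acting_maps" and D: "defect G Q F \<in> carrier (C 2)" and c: "c \<in> carrier (C 1)"
  shows "defect G Q (twist c F) = d 1 c \<otimes>\<^bsub>C 2\<^esub> defect G Q F"
proof (rule ext)
  fix xs
  show "defect G Q (twist c F) xs = (d 1 c \<otimes>\<^bsub>C 2\<^esub> defect G Q F) xs"
  proof (cases "xs \<in> tuples (carrier G) 2")
    case True
    then obtain x y where xs: "xs = [x, y]" and xy: "x \<in> carrier G" "y \<in> carrier G"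
      by (auto simp: tuples_2)
    have c': "c [z] \<in> carrier A" if "z \<in> carrier G" for z
      using c that by (auto simp: C_closed)
    note mem = xy c'[OF xy(1)] c'[OF xy(2)] c'[OF G.m_closed[OF xy]]
      acting_closed[OF F xy(1)] acting_closed[OF F xy(2)] acting_closed[OF F G.m_closed[OF xy]]
    let ?cz = "inv\<^bsub>Q\<^esub> c [x \<otimes>\<^bsub>G\<^esub> y]"
    let ?D = "F x \<otimes>\<^bsub>Q\<^esub> F y \<otimes>\<^bsub>Q\<^esub> inv\<^bsub>Q\<^esub> F (x \<otimes>\<^bsub>G\<^esub> y)"
    have DA: "?D \<in> carrier A"
      using C_closed[OF D, of "[x, y]"] xy by (simp add: defect_pair)
    have "defect G Q (twist c F) [x, y]
      = c [x] \<otimes>\<^bsub>Q\<^esub> (F x \<otimes>\<^bsub>Q\<^esub> c [y]) \<otimes>\<^bsub>Q\<^esub> F y \<otimes>\<^bsub>Q\<^esub> (inv\<^bsub>Q\<^esub> F (x \<otimes>\<^bsub>G\<^esub> y) \<otimes>\<^bsub>Q\<^esub> ?cz)"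
      using mem by (simp add: defect_pair Q.m_assoc Q.inv_mult_group)
    also have "\<dots> = c [x] \<otimes>\<^bsub>Q\<^esub> \<rho> x (c [y]) \<otimes>\<^bsub>Q\<^esub> ?D \<otimes>\<^bsub>Q\<^esub> ?cz"
      using mem by (simp add: acting_swap[OF F] Q.m_assoc)
    also have "\<dots> = (\<rho> x (c [y]) \<otimes>\<^bsub>A\<^esub> inv\<^bsub>A\<^esub> c [x \<otimes>\<^bsub>G\<^esub> y] \<otimes>\<^bsub>A\<^esub> c [x]) \<otimes>\<^bsub>A\<^esub> ?D"
      using mem DA by (simp add: A.m_ac flip: mult_A inv_A)
    finally show ?thesis
      using xy unfolding xs mult_C by (simp add: diff_1[OF c xy, simplified] defect_pair)
  qed (simp add: defect_def mult_C)
qed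

text \<open>
  Both ways of bracketing \<open>F x F y F z\<close> lead to \<open>F (x y z)\<close>; comparing the factors that they
  pick up gives the cocycle identity.
\<close>

lemma defect_cocycle:
  assumes F: "F \<in> acting_maps" and D: "defect G Q F \<in> carrier (C 2)"
  shows "d 2 (defect G Q F) = \<one>\<^bsub>C 3\<^esub>"
proof (rule C_eqI)
  show "d 2 (defect G Q F) \<in> carrier (C 3)"
    using d.hom_closed[OF D] by (simp add: numeral_3_eq_3 numeral_2_eq_2)
  fix xs assume "xs \<in> tuples (carrier G) 3"
  then obtain x y z where xs: "xs = [x, y, z]"
    and xyz: "x \<in> carrier G" "y \<in> carrier G" "z \<in> carrier G"
    by (auto simp: tuples_3)
  let ?D = "\<lambda>u v. defect G Q F [u, v]"
  have DA: "?D u v \<in> carrier A" if "u \<in> carrier G" "v \<in> carrier G" for u v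
    using C_closed[OF D] that by simp
  have D_mult: "F u \<otimes>\<^bsub>Q\<^esub> F v = ?D u v \<otimes>\<^bsub>Q\<^esub> F (u \<otimes>\<^bsub>G\<^esub> v)"
    if "u \<in> carrier G" "v \<in> carrier G" for u v
    using that acting_closed[OF F] by (simp add: defect_pair Q.m_assoc)
  note mem = xyz DA acting_closed[OF F]
  have "(\<rho> x (?D y z) \<otimes>\<^bsub>Q\<^esub> ?D x (y \<otimes>\<^bsub>G\<^esub> z)) \<otimes>\<^bsub>Q\<^esub> F (x \<otimes>\<^bsub>G\<^esub> y \<otimes>\<^bsub>G\<^esub> z)
      = F x \<otimes>\<^bsub>Q\<^esub> ?D y z \<otimes>\<^bsub>Q\<^esub> F (y \<otimes>\<^bsub>G\<^esub> z)"
    using mem by (simp add: acting_swap[OF F] Q.m_assoc D_mult G.m_assoc)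
  also have "\<dots> = F x \<otimes>\<^bsub>Q\<^esub> F y \<otimes>\<^bsub>Q\<^esub> F z"
    using mem by (simp add: Q.m_assoc D_mult[of y z, symmetric])
  also have "\<dots> = (?D x y \<otimes>\<^bsub>Q\<^esub> ?D (x \<otimes>\<^bsub>G\<^esub> y) z) \<otimes>\<^bsub>Q\<^esub> F (x \<otimes>\<^bsub>G\<^esub> y \<otimes>\<^bsub>G\<^esub> z)"
  proof -
    have "F x \<otimes>\<^bsub>Q\<^esub> F y \<otimes>\<^bsub>Q\<^esub> F z = ?D x y \<otimes>\<^bsub>Q\<^esub> (F (x \<otimes>\<^bsub>G\<^esub> y) \<otimes>\<^bsub>Q\<^esub> F z)"
      using mem by (simp add: D_mult[of x y] Q.m_assoc del: Q.l_inv)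
    then show ?thesis
      using mem by (simp add: D_mult[of "x \<otimes>\<^bsub>G\<^esub> y" z] Q.m_assoc)
  qed
  finally have "\<rho> x (?D y z) \<otimes>\<^bsub>A\<^esub> ?D x (y \<otimes>\<^bsub>G\<^esub> z) = ?D x y \<otimes>\<^bsub>A\<^esub> ?D (x \<otimes>\<^bsub>G\<^esub> y) z"
    using mem by (simp add: mult_A)
  moreover have "d 2 (defect G Q F) [x, y, z] = (\<rho> x (?D y z) \<otimes>\<^bsub>A\<^esub> ?D x (y \<otimes>\<^bsub>G\<^esub> z)) \<otimes>\<^bsub>A\<^esub>
      inv\<^bsub>A\<^esub> (?D x y \<otimes>\<^bsub>A\<^esub> ?D (x \<otimes>\<^bsub>G\<^esub> y) z)"
    using mem by (simp add: diff_2[OF D] A.inv_mult A.m_ac)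
  ultimately show "d 2 (defect G Q F) xs = \<one>\<^bsub>C 3\<^esub> xs"
    unfolding xs using mem by (simp add: one_C)
qed simp

text \<open>
  In the abelian group \<open>A\<close> the factors \<open>\<rho> x a\<close> and \<open>a\<^sup>-\<^sup>1\<close> of the coboundary commute, and
  \<open>\<rho> x a F x = F x a\<close>. This is why coboundaries act by conjugation.
\<close>

lemma twist_coboundary:
  assumes F: "F \<in> acting_maps" and \<mu>: "\<mu> \<in> carrier (C 0)" and x: "x \<in> carrier G"
  shows "twist (d 0 \<mu>) F x = inv\<^bsub>Q\<^esub> \<mu> [] \<otimes>\<^bsub>Q\<^esub> F x \<otimes>\<^bsub>Q\<^esub> \<mu> []"
proof -
  have a: "\<mu> [] \<in> carrier A" using \<mu> by (auto simp: C_closed)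
  have "twist (d 0 \<mu>) F x = (inv\<^bsub>Q\<^esub> \<mu> [] \<otimes>\<^bsub>Q\<^esub> \<rho> x (\<mu> [])) \<otimes>\<^bsub>Q\<^esub> F x"
    using a x A_comm by (simp add: diff_0[OF \<mu>] mult_A inv_A A_inv_closed)
  also have "\<dots> = inv\<^bsub>Q\<^esub> \<mu> [] \<otimes>\<^bsub>Q\<^esub> F x \<otimes>\<^bsub>Q\<^esub> \<mu> []"
    using a x acting_closed[OF F x] by (simp add: acting_swap[OF F] Q.m_assoc)
  finally show ?thesis .
qed

end

section \<open>Weak morphs as maps into the quotient\<close>

text \<open>
  A class consists of all weak morphs that pick their values from prescribed left cosets, and left
  cosets that share an element coincide.
\<close>

lemma weak_class_eq_iff:
  assumes K: "group K" and H: "subgroup H K"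
    and f: "f \<in> weak_morphs G L K H" and g: "g \<in> weak_morphs G L K H"
  shows "weak_class G L K H f = weak_class G L K H g \<longleftrightarrow>
    (\<forall>x\<in>carrier G. g x \<in> f x <#\<^bsub>K\<^esub> H)"
proof -
  interpret K: group K by (rule K)
  have val: "u x \<in> carrier K" if "u \<in> weak_morphs G L K H" "x \<in> carrier G" for u x
    using that by (auto simp: weak_morphs_def)
  have "g \<in> weak_class G L K H g"
    using g val K.lcos_self[OF _ H] by (auto simp: weak_class_def weak_equiv_def)
  moreover have "weak_class G L K H f = weak_class G L K H g"
    if "\<forall>x\<in>carrier G. g x \<in> f x <#\<^bsub>K\<^esub> H"
  proof -
    have "f x <#\<^bsub>K\<^esub> H = g x <#\<^bsub>K\<^esub> H" if "x \<in> carrier G" for x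
      using K.l_repr_independence[OF _ val[OF f that] H] that
        \<open>\<forall>x\<in>carrier G. g x \<in> f x <#\<^bsub>K\<^esub> H\<close> by blast
    then show ?thesis
      using f g by (auto simp: weak_class_def weak_equiv_def)
  qed
  ultimately show ?thesis
    by (auto simp: weak_class_def weak_equiv_def)
qed

text \<open>
  Applied to \<open>Ht\<close>, this shows that every map into \<open>N\<close> satisfies the normalizer condition in the
  definition of a weak \<open>(L, Ht)\<close>-morph.
\<close>

lemma (in normal) normalizer_eq_carrier: "normalizer G H = carrier G"
proof -
  have "g <# H #> inv g = H" if "g \<in> carrier G" for g
  proof -
    have "g <# H #> inv g = H #> g #> inv g"
      using coset_eq that by simp
    then show ?thesis
      using that subset by (simp add: coset_mult_assoc)
  qed
  then show ?thesis
    using subset by (auto simp: normalizer_def stabilizer_def)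
qed

lemma (in normal) mem_lcos_iff:
  assumes "a \<in> carrier G" "b \<in> carrier G"
  shows "a \<in> b <# H \<longleftrightarrow> a \<otimes> inv b \<in> H"
  using rcos_module[OF is_group] coset_eq assms by metis

text \<open>
  The setting of the theorem. The objects that are determined by the others (the normalizer, the
  module, the sets of morphs and classes) stay variables with defining equations, so that results
  proved here speak about them literally.
\<close>

locale weak_morph_extension =
  fixes G :: "('a, 'm) monoid_scheme" and K :: "('b, 'n) monoid_scheme"
    and L :: "'a set" and H Ht N :: "'b set" and KN :: "('b, 'n) monoid_scheme"
    and A :: "'b set monoid"
    and \<theta> :: "'a \<Rightarrow> 'b" and \<rho> :: "'a \<Rightarrow> 'b set \<Rightarrow> 'b set"
    and Mt M :: "('a \<Rightarrow> 'b) set" and Et E :: "('a \<Rightarrow> 'b) set set"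
  assumes group_G: "group G" and subgroup_L: "subgroup L G"
    and group_K: "group K" and subgroup_H: "subgroup H K"
    and N: "N = normalizer K H" and KN: "KN = K\<lparr>carrier := N\<rparr>"
    and \<theta>_hom: "\<theta> \<in> hom (G\<lparr>carrier := L\<rparr>) KN"
    and subgroup_Ht: "subgroup Ht (K\<lparr>carrier := H\<rparr>)" and normal_Ht: "Ht \<lhd> KN"
    and A: "A = K\<lparr>carrier := H\<rparr> Mod Ht" and comm_group_A: "comm_group A"
    and \<rho>_hom: "\<rho> \<in> hom G (AutoGroup A)"
    and Mt: "Mt = {f \<in> weak_morphs_rest G L KN Ht \<theta>. defines_action G K H Ht \<rho> f}"
    and M: "M = {f \<in> weak_morphs_rest G L K H \<theta>. defines_action G K H Ht \<rho> f}"
    and Et: "Et = weak_class G L KN Ht ` Mt"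
    and E: "E = weak_class G L K H ` M"
begin

abbreviation Q :: "'b set monoid"
  where "Q \<equiv> KN Mod Ht"

abbreviation \<pi> :: "'b \<Rightarrow> 'b set"
  where "\<pi> k \<equiv> k <#\<^bsub>K\<^esub> Ht"

sublocale K: group K
  by (rule group_K)

lemma N_subgroup: "subgroup N K"
  unfolding N by (rule K.normalizer_imp_subgroup) (rule subgroup.subset[OF subgroup_H])

lemma N_carrier: "k \<in> N \<Longrightarrow> k \<in> carrier K"
  using N_subgroup by (rule subgroup.mem_carrier)

sublocale KN: group KN
  unfolding KN by (rule K.subgroup_imp_group) (rule N_subgroup)

sublocale Ht: normal Ht KN
  by (rule normal_Ht)

sublocale H: normal H KN
  unfolding KN N by (rule K.subgroup_in_normalizer) (rule subgroup_H)

lemma carrier_KN [simp]: "carrier KN = N"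
  by (simp add: KN)

lemma mult_KN [simp]: "x \<otimes>\<^bsub>KN\<^esub> y = x \<otimes>\<^bsub>K\<^esub> y"
  by (simp add: KN)

lemma one_KN [simp]: "\<one>\<^bsub>KN\<^esub> = \<one>\<^bsub>K\<^esub>"
  by (simp add: KN)

lemma lcos_KN [simp]: "x <#\<^bsub>KN\<^esub> S = x <#\<^bsub>K\<^esub> S"
  by (simp add: KN)

lemma rcos_KN: "S #>\<^bsub>KN\<^esub> x = S #>\<^bsub>K\<^esub> x"
  by (simp add: KN)

lemma inv_KN [simp]: "x \<in> N \<Longrightarrow> inv\<^bsub>KN\<^esub> x = inv\<^bsub>K\<^esub> x"
  unfolding KN by (rule K.m_inv_consistent[OF N_subgroup])

lemma H_N: "h \<in> H \<Longrightarrow> h \<in> N"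
  using H.mem_carrier by simp

lemma Ht_H: "h \<in> Ht \<Longrightarrow> h \<in> H"
  using subgroup.mem_carrier[OF subgroup_Ht] by simp

lemma N_mult [intro]: "x \<in> N \<Longrightarrow> y \<in> N \<Longrightarrow> x \<otimes>\<^bsub>K\<^esub> y \<in> N"
  using N_subgroup by (rule subgroup.m_closed)

lemma N_inv [intro]: "x \<in> N \<Longrightarrow> inv\<^bsub>K\<^esub> x \<in> N"
  using N_subgroup by (rule subgroup.m_inv_closed)

lemma rcos_eq_\<pi>: "k \<in> N \<Longrightarrow> Ht #>\<^bsub>K\<^esub> k = \<pi> k"
  using Ht.coset_eq by (simp add: KN)

lemma \<pi>_hom: "group_hom KN Q \<pi>"
proof -
  have "(\<lambda>k. Ht #>\<^bsub>KN\<^esub> k) \<in> hom KN Q"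
    by (rule Ht.r_coset_hom_Mod)
  then have "\<pi> \<in> hom KN Q"
    by (simp add: hom_def Pi_iff rcos_eq_\<pi> rcos_KN N_mult)
  then show ?thesis
    by (intro group_hom.intro group_hom_axioms.intro KN.is_group Ht.factorgroup_is_group)
qed

sublocale Q: group Q
  by (rule Ht.factorgroup_is_group)

sublocale \<pi>: group_hom KN Q \<pi>
  by (rule \<pi>_hom)

lemma \<pi>_closed [simp, intro]: "k \<in> N \<Longrightarrow> \<pi> k \<in> carrier Q"
  using \<pi>.hom_closed by simp

lemma \<pi>_mult: "x \<in> N \<Longrightarrow> y \<in> N \<Longrightarrow> \<pi> (x \<otimes>\<^bsub>K\<^esub> y) = \<pi> x \<otimes>\<^bsub>Q\<^esub> \<pi> y"
  using \<pi>.hom_mult[of x y] by simp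

lemma \<pi>_inv: "x \<in> N \<Longrightarrow> \<pi> (inv\<^bsub>K\<^esub> x) = inv\<^bsub>Q\<^esub> \<pi> x"
  using \<pi>.hom_inv[of x] by simp

lemma \<pi>_one: "\<pi> \<one>\<^bsub>K\<^esub> = \<one>\<^bsub>Q\<^esub>"
  using \<pi>.hom_one by simp

lemma \<pi>_eq_iff: "x \<in> N \<Longrightarrow> y \<in> N \<Longrightarrow> \<pi> x = \<pi> y \<longleftrightarrow> y \<in> x <#\<^bsub>K\<^esub> Ht"
  using KN.l_repr_independence[of y x Ht] KN.lcos_self[of y Ht] normal_imp_subgroup[OF normal_Ht]
  by auto

lemma \<pi>_eq_one_iff: "x \<in> N \<Longrightarrow> \<pi> x = \<one>\<^bsub>Q\<^esub> \<longleftrightarrow> x \<in> Ht"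
  using \<pi>_eq_iff[of "\<one>\<^bsub>K\<^esub>" x] \<pi>_one KN.one_closed Ht.mem_carrier
    KN.lcos_mult_one[of Ht] Ht.subset by auto

lemma carrier_A: "carrier A = \<pi> ` H"
  using rcos_eq_\<pi> H_N by (auto simp: A carrier_FactGroup image_iff)

text \<open>
  The cosets of \<open>Ht\<close> in \<open>H\<close> are the same sets as in \<open>N\<close>, and multiplication of subsets refers to
  the multiplication of \<open>K\<close> only; so \<open>H / Ht\<close> lies in \<open>N / Ht\<close> without any identification.
\<close>

lemma A_in_Q: "A = Q\<lparr>carrier := carrier A\<rparr>"
  by (simp add: A KN FactGroup_def set_mult_def fun_eq_iff)

lemma A_subgroup_Q: "subgroup (carrier A) Q"
proof -
  have "subgroup (\<pi> ` H) Q"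
    using \<pi>.subgroup_img_is_subgroup H.subgroup_axioms by blast
  then show ?thesis by (simp add: carrier_A)
qed

lemma \<pi>_mem_A_iff: "k \<in> N \<Longrightarrow> \<pi> k \<in> carrier A \<longleftrightarrow> k \<in> H"
proof
  assume k: "k \<in> N" and "\<pi> k \<in> carrier A"
  then obtain h where h: "h \<in> H" "\<pi> h = \<pi> k" by (auto simp: carrier_A)
  then have "k \<in> h <#\<^bsub>K\<^esub> Ht" using \<pi>_eq_iff k H_N by blast
  then show "k \<in> H"
    using h Ht_H H.m_closed by (auto simp: l_coset_def)
qed (auto simp: carrier_A)

sublocale module_in_group G A Q L \<rho>
  by (intro module_in_group.intro relative_module.intro relative_module_axioms.intro
      module_in_group_axioms.intro group_G comm_group_A subgroup_L \<rho>_hom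
      Ht.factorgroup_is_group A_subgroup_Q A_in_Q)

(* Unfolding products in Q to products of subsets would hide them from the group laws. *)
declare mult_FactGroup [simp del] one_FactGroup [simp del]

text \<open>
  What the two kinds of weak morphs over \<open>\<theta>\<close> that define \<open>\<rho>\<close> have in common. By \<open>Mt_iff\<close> and
  \<open>M_iff\<close> below, they differ only in the condition on the defect: trivial for weak
  \<open>(L, Ht)\<close>-morphs, with values in \<open>A\<close> for weak \<open>(L, H)\<close>-morphs.
\<close>

definition \<theta>_maps :: "('a \<Rightarrow> 'b) set"
  where "\<theta>_maps = {f \<in> carrier G \<rightarrow>\<^sub>E N.
    (\<forall>l\<in>L. f l = \<theta> l) \<and> (\<lambda>x. \<pi> (f x)) \<in> acting_maps}"

abbreviation class\<^sub>t :: "('a \<Rightarrow> 'b) \<Rightarrow> ('a \<Rightarrow> 'b) set"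
  where "class\<^sub>t \<equiv> weak_class G L KN Ht"

abbreviation class\<^sub>H :: "('a \<Rightarrow> 'b) \<Rightarrow> ('a \<Rightarrow> 'b) set"
  where "class\<^sub>H \<equiv> weak_class G L K H"

lemma defines_action_iff:
  assumes f: "f \<in> carrier G \<rightarrow> N"
  shows "defines_action G K H Ht \<rho> f \<longleftrightarrow> (\<lambda>x. \<pi> (f x)) \<in> acting_maps"
proof -
  have "\<pi> (f x \<otimes>\<^bsub>K\<^esub> h \<otimes>\<^bsub>K\<^esub> inv\<^bsub>K\<^esub> f x) = \<pi> (f x) \<otimes>\<^bsub>Q\<^esub> \<pi> h \<otimes>\<^bsub>Q\<^esub> inv\<^bsub>Q\<^esub> \<pi> (f x)"
    if "x \<in> carrier G" "h \<in> H" for x h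
    using f that by (simp add: Pi_iff \<pi>_mult \<pi>_inv H_N N_mult N_inv)
  then show ?thesis
    using f by (auto simp: defines_action_def acting_maps_def carrier_A)
qed

text \<open>
  The quasi-multiplicativity of \<open>f\<close> modulo \<open>Ht\<close> is multiplicativity of \<open>\<pi> \<circ> f\<close>.
\<close>

lemma weak_morphs_Ht_iff:
  "f \<in> weak_morphs G L KN Ht \<longleftrightarrow> f \<in> carrier G \<rightarrow>\<^sub>E N \<and> f \<in> hom (G\<lparr>carrier := L\<rparr>) KN
    \<and> defect G Q (\<lambda>x. \<pi> (f x)) = \<one>\<^bsub>C 2\<^esub>"
proof (cases "f \<in> carrier G \<rightarrow>\<^sub>E N")
  case True
  then have f: "f x \<in> N" if "x \<in> carrier G" for x using that by auto
  have "f x \<otimes>\<^bsub>K\<^esub> f y \<in> f (x \<otimes>\<^bsub>G\<^esub> y) <#\<^bsub>K\<^esub> Ht \<longleftrightarrow>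
      \<pi> (f x) \<otimes>\<^bsub>Q\<^esub> \<pi> (f y) = \<pi> (f (x \<otimes>\<^bsub>G\<^esub> y))"
    if "x \<in> carrier G" "y \<in> carrier G" for x y
    using that f \<pi>_eq_iff[of "f (x \<otimes>\<^bsub>G\<^esub> y)" "f x \<otimes>\<^bsub>K\<^esub> f y"] \<pi>_mult[of "f x" "f y"] N_mult
    by auto
  then show ?thesis
    using True f by (auto simp: weak_morphs_def defect_one_iff Ht.normalizer_eq_carrier)
qed (simp add: weak_morphs_def)

text \<open>
  As \<open>H\<close> is normal in \<open>N\<close>, the left coset condition \<open>f x f y \<in> f(x y) H\<close> can be rewritten with the
  factor from \<open>H\<close> on the left, which is the form of the defect.
\<close>

lemma weak_morphs_H_iff:
  "f \<in> weak_morphs G L K H \<longleftrightarrow> f \<in> carrier G \<rightarrow>\<^sub>E N \<and> f \<in> hom (G\<lparr>carrier := L\<rparr>) KN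
    \<and> defect G Q (\<lambda>x. \<pi> (f x)) \<in> carrier (C 2)"
proof (cases "f \<in> carrier G \<rightarrow>\<^sub>E N")
  case True
  then have f: "f x \<in> N" if "x \<in> carrier G" for x using that by auto
  have *: "f x \<otimes>\<^bsub>K\<^esub> f y \<in> f (x \<otimes>\<^bsub>G\<^esub> y) <#\<^bsub>K\<^esub> H \<longleftrightarrow>
      defect G Q (\<lambda>x. \<pi> (f x)) [x, y] \<in> carrier A"
    if "x \<in> carrier G" "y \<in> carrier G" for x y
  proof -
    note mem = f[OF that(1)] f[OF that(2)] f[OF G.m_closed[OF that]]
    have "f x \<otimes>\<^bsub>K\<^esub> f y \<in> f (x \<otimes>\<^bsub>G\<^esub> y) <#\<^bsub>K\<^esub> H \<longleftrightarrow>
        f x \<otimes>\<^bsub>K\<^esub> f y \<otimes>\<^bsub>K\<^esub> inv\<^bsub>K\<^esub> f (x \<otimes>\<^bsub>G\<^esub> y) \<in> H"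
      using H.mem_lcos_iff[of "f x \<otimes>\<^bsub>K\<^esub> f y" "f (x \<otimes>\<^bsub>G\<^esub> y)"] mem N_mult by simp
    also have "\<dots> \<longleftrightarrow> \<pi> (f x \<otimes>\<^bsub>K\<^esub> f y \<otimes>\<^bsub>K\<^esub> inv\<^bsub>K\<^esub> f (x \<otimes>\<^bsub>G\<^esub> y)) \<in> carrier A"
      using \<pi>_mem_A_iff mem N_mult N_inv by simp
    finally show ?thesis
      using mem that by (simp add: defect_pair \<pi>_mult \<pi>_inv N_mult N_inv)
  qed
  have "defect G Q (\<lambda>x. \<pi> (f x)) \<in> carrier (C 2) \<longleftrightarrow>
      (\<forall>x\<in>carrier G. \<forall>y\<in>carrier G. defect G Q (\<lambda>x. \<pi> (f x)) [x, y] \<in> carrier A)"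
  proof
    assume R: "\<forall>x\<in>carrier G. \<forall>y\<in>carrier G. defect G Q (\<lambda>x. \<pi> (f x)) [x, y] \<in> carrier A"
    show "defect G Q (\<lambda>x. \<pi> (f x)) \<in> carrier (C 2)"
      unfolding carrier_C
    proof (rule PiE_I)
      fix xs assume "xs \<in> tuples (carrier G) 2"
      then show "defect G Q (\<lambda>x. \<pi> (f x)) xs \<in> carrier A"
        using R by (auto simp: tuples_2)
    qed (simp add: defect_def)
  qed (simp add: C_closed)
  moreover have "f \<in> hom (G\<lparr>carrier := L\<rparr>) K \<longleftrightarrow> f \<in> hom (G\<lparr>carrier := L\<rparr>) KN"
    using f L_subset N_carrier by (auto simp: hom_def)
  moreover have "f \<in> carrier G \<rightarrow>\<^sub>E carrier K"
    using True N_carrier by auto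
  ultimately show ?thesis
    using True f * by (auto simp: weak_morphs_def N[symmetric])
next
  case False
  then show ?thesis
    by (auto simp: weak_morphs_def N[symmetric] PiE_iff)
qed

lemma \<theta>_hom_cong: "\<forall>l\<in>L. f l = \<theta> l \<Longrightarrow> f \<in> hom (G\<lparr>carrier := L\<rparr>) KN"
  using \<theta>_hom subgroup.m_closed[OF subgroup_L] by (auto simp: hom_def)

lemma Mt_iff: "f \<in> Mt \<longleftrightarrow> f \<in> \<theta>_maps \<and> defect G Q (\<lambda>x. \<pi> (f x)) = \<one>\<^bsub>C 2\<^esub>"
  using \<theta>_hom_cong[of f] defines_action_iff[of f]
  by (auto simp: Mt weak_morphs_rest_def weak_morphs_Ht_iff \<theta>_maps_def)

lemma M_iff: "f \<in> M \<longleftrightarrow> f \<in> \<theta>_maps \<and> defect G Q (\<lambda>x. \<pi> (f x)) \<in> carrier (C 2)"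
  using \<theta>_hom_cong[of f] defines_action_iff[of f]
  by (auto simp: M weak_morphs_rest_def weak_morphs_H_iff \<theta>_maps_def)

lemma Mt_weak: "f \<in> Mt \<Longrightarrow> f \<in> weak_morphs G L KN Ht"
  by (simp add: Mt weak_morphs_rest_def)

lemma M_weak: "f \<in> M \<Longrightarrow> f \<in> weak_morphs G L K H"
  by (simp add: M weak_morphs_rest_def)

lemma Mt_subset_M: "f \<in> Mt \<Longrightarrow> f \<in> M"
  by (simp add: Mt_iff M_iff)

lemma \<theta>_maps_N: "f \<in> \<theta>_maps \<Longrightarrow> x \<in> carrier G \<Longrightarrow> f x \<in> N"
  by (auto simp: \<theta>_maps_def)

lemma \<theta>_maps_acting: "f \<in> \<theta>_maps \<Longrightarrow> (\<lambda>x. \<pi> (f x)) \<in> acting_maps"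
  by (simp add: \<theta>_maps_def)

lemma class\<^sub>t_eq_iff:
  assumes "f \<in> Mt" "g \<in> Mt"
  shows "class\<^sub>t f = class\<^sub>t g \<longleftrightarrow> (\<forall>x\<in>carrier G. \<pi> (f x) = \<pi> (g x))"
  using weak_class_eq_iff[OF KN.is_group Ht.subgroup_axioms assms[THEN Mt_weak]] \<pi>_eq_iff
    \<theta>_maps_N assms by (simp add: Mt_iff)

lemma class\<^sub>H_eq_iff:
  assumes "f \<in> M" "g \<in> M"
  shows "class\<^sub>H f = class\<^sub>H g \<longleftrightarrow> (\<forall>x\<in>carrier G. g x \<otimes>\<^bsub>K\<^esub> inv\<^bsub>K\<^esub> f x \<in> H)"
proof -
  have "g x \<in> f x <#\<^bsub>K\<^esub> H \<longleftrightarrow> g x \<otimes>\<^bsub>K\<^esub> inv\<^bsub>K\<^esub> f x \<in> H" if "x \<in> carrier G" for x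
    using H.mem_lcos_iff[of "g x" "f x"] \<theta>_maps_N that assms by (simp add: M_iff)
  then show ?thesis
    using weak_class_eq_iff[OF group_K subgroup_H assms[THEN M_weak]] by simp
qed

lemma sharp_eq_defect:
  assumes "f \<in> \<theta>_maps"
  shows "sharp G K Ht f = defect G Q (\<lambda>x. \<pi> (f x))"
  unfolding sharp_def defect_def
  by (rule restrict_ext)
    (use \<theta>_maps_N[OF assms] in \<open>auto simp: tuples_2 \<pi>_mult \<pi>_inv N_mult N_inv\<close>)

section \<open>Lifting cochains\<close>

lemma mult_left_apply: "x \<in> carrier G \<Longrightarrow> mult_left G K u f x = u x \<otimes>\<^bsub>K\<^esub> f x"
  by (simp add: mult_left_def)

text \<open>
  The value 1 at 1 can be prescribed because \<open>1 \<in> L\<close>, so that \<open>c\<close> is trivial at 1.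
\<close>

lemma lift_exists:
  assumes c: "c \<in> rel_cochains G L A \<rho> 1"
  shows "\<exists>u. is_lift G K H Ht c u"
proof -
  define s where "s a = (if a = \<one>\<^bsub>A\<^esub> then \<one>\<^bsub>K\<^esub> else SOME h. h \<in> H \<and> \<pi> h = a)" for a
  have s: "s a \<in> H \<and> \<pi> (s a) = a" if "a \<in> carrier A" for a
  proof (cases "a = \<one>\<^bsub>A\<^esub>")
    case True
    then show ?thesis
      using H.one_closed by (simp add: s_def one_A \<pi>_one)
  next
    case False
    moreover have "\<exists>h. h \<in> H \<and> \<pi> h = a"
      using that by (auto simp: carrier_A)
    ultimately show ?thesis
      using someI_ex[of "\<lambda>h. h \<in> H \<and> \<pi> h = a"] by (simp add: s_def)
  qed
  have "c [\<one>\<^bsub>G\<^esub>] = \<one>\<^bsub>A\<^esub>"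
    using c one_in_L by (simp add: rel_cochains_def)
  then have "is_lift G K H Ht c (\<lambda>x. s (c [x]))"
    unfolding is_lift_def A[symmetric] using s
    by (intro bexI[of _ s] conjI ballI refl) (auto simp: s_def)
  then show ?thesis by blast
qed

text \<open>
  On \<open>L\<close> the cochain \<open>c\<close> takes the same value as at 1, hence so does its composite with a section.
\<close>

lemma lift_properties:
  assumes c: "c \<in> rel_cochains G L A \<rho> 1" and u: "is_lift G K H Ht c u"
  shows "x \<in> carrier G \<Longrightarrow> u x \<in> H" "x \<in> carrier G \<Longrightarrow> \<pi> (u x) = c [x]"
    "l \<in> L \<Longrightarrow> u l = \<one>\<^bsub>K\<^esub>"
proof -
  obtain s where sH: "s \<in> carrier A \<rightarrow> H"
    and s\<pi>: "\<forall>a\<in>carrier A. \<pi> (s a) = a"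
    and us: "\<forall>x\<in>carrier G. u x = s (c [x])" and u1: "u \<one>\<^bsub>G\<^esub> = \<one>\<^bsub>K\<^esub>"
    using u unfolding is_lift_def A[symmetric] by (elim bexE conjE)
  have cA: "c [x] \<in> carrier A" if "x \<in> carrier G" for x
    using c that by (auto simp: rel_cochains_def C_closed)
  show "x \<in> carrier G \<Longrightarrow> u x \<in> H" "x \<in> carrier G \<Longrightarrow> \<pi> (u x) = c [x]"
    using sH s\<pi> us cA by (simp_all add: Pi_iff)
  have "c [l] = c [\<one>\<^bsub>G\<^esub>]" if "l \<in> L"
    using c one_in_L that by (simp add: rel_cochains_def)
  then show "l \<in> L \<Longrightarrow> u l = \<one>\<^bsub>K\<^esub>"
    using bspec[OF us, of l] bspec[OF us G.one_closed] u1 L_subset[of l] by simp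
qed

text \<open>
  Multiplying by a lift changes neither the restriction to \<open>L\<close>, where the lift is 1, nor the induced
  action, since \<open>A\<close> is abelian and so its own elements act trivially on it by conjugation.
\<close>

lemma mult_left_lift:
  assumes c: "c \<in> rel_cochains G L A \<rho> 1" and u: "is_lift G K H Ht c u" and f: "f \<in> \<theta>_maps"
  shows "mult_left G K u f \<in> \<theta>_maps"
    and "x \<in> carrier G \<Longrightarrow> \<pi> (mult_left G K u f x) = twist c (\<lambda>x. \<pi> (f x)) x"
proof -
  note u' = lift_properties[OF c u]
  have tw: "\<pi> (mult_left G K u f x) = twist c (\<lambda>x. \<pi> (f x)) x" if "x \<in> carrier G" for x
    using that u' \<theta>_maps_N[OF f] H_N by (simp add: mult_left_apply \<pi>_mult flip: u'(2))
  then show "x \<in> carrier G \<Longrightarrow> \<pi> (mult_left G K u f x) = twist c (\<lambda>x. \<pi> (f x)) x" .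
  have N: "mult_left G K u f \<in> carrier G \<rightarrow>\<^sub>E N"
    using u'(1) \<theta>_maps_N[OF f] H_N N_mult by (auto simp: mult_left_def)
  have "mult_left G K u f l = \<theta> l" if "l \<in> L" for l
  proof -
    have "f l \<in> carrier K" using \<theta>_maps_N[OF f] N_carrier L_subset that by blast
    then show ?thesis
      using that u'(3) f L_subset by (simp add: mult_left_apply \<theta>_maps_def)
  qed
  moreover have "(\<lambda>x. \<pi> (mult_left G K u f x)) \<in> acting_maps"
    unfolding acting_maps_def
  proof (intro CollectI conjI ballI Pi_I)
    fix x assume "x \<in> carrier G"
    then show "\<pi> (mult_left G K u f x) \<in> carrier Q"
      using N by (auto simp: PiE_iff)
  next
    fix x a assume x: "x \<in> carrier G" and a: "a \<in> carrier A"
    have c': "c [x] \<in> carrier A"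
      using u'(1,2) x by (auto simp: carrier_A)
    have F: "\<pi> (f x) \<in> carrier Q"
      using \<theta>_maps_N[OF f x] by blast
    have "\<pi> (mult_left G K u f x) \<otimes>\<^bsub>Q\<^esub> a \<otimes>\<^bsub>Q\<^esub> inv\<^bsub>Q\<^esub> \<pi> (mult_left G K u f x)
        = c [x] \<otimes>\<^bsub>Q\<^esub> (\<pi> (f x) \<otimes>\<^bsub>Q\<^esub> a \<otimes>\<^bsub>Q\<^esub> inv\<^bsub>Q\<^esub> \<pi> (f x)) \<otimes>\<^bsub>Q\<^esub> inv\<^bsub>Q\<^esub> c [x]"
      using x a c' F A_subset[OF c'] A_subset[OF a]
      by (simp add: tw Q.inv_mult_group Q.m_assoc)
    also have "\<dots> = c [x] \<otimes>\<^bsub>Q\<^esub> \<rho> x a \<otimes>\<^bsub>Q\<^esub> inv\<^bsub>Q\<^esub> c [x]"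
      using acting_conj[OF \<theta>_maps_acting[OF f] x a] by simp
    also have "\<dots> = \<rho> x a \<otimes>\<^bsub>A\<^esub> (c [x] \<otimes>\<^bsub>A\<^esub> inv\<^bsub>A\<^esub> c [x])"
      using x a c' by (simp add: A.m_ac del: A.r_inv flip: mult_A inv_A)
    finally show "\<rho> x a = \<pi> (mult_left G K u f x) \<otimes>\<^bsub>Q\<^esub> a \<otimes>\<^bsub>Q\<^esub>
        inv\<^bsub>Q\<^esub> \<pi> (mult_left G K u f x)"
      using x a c' by simp
  qed
  ultimately show "mult_left G K u f \<in> \<theta>_maps"
    using N by (simp add: \<theta>_maps_def)
qed

lemma defect_mult_left:
  assumes c: "c \<in> rel_cochains G L A \<rho> 1" and u: "is_lift G K H Ht c u" and f: "f \<in> M"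
  shows "defect G Q (\<lambda>x. \<pi> (mult_left G K u f x)) = d 1 c \<otimes>\<^bsub>C 2\<^esub> defect G Q (\<lambda>x. \<pi> (f x))"
proof -
  have f': "f \<in> \<theta>_maps" "defect G Q (\<lambda>x. \<pi> (f x)) \<in> carrier (C 2)"
    using f by (auto simp: M_iff)
  have "defect G Q (\<lambda>x. \<pi> (mult_left G K u f x)) = defect G Q (twist c (\<lambda>x. \<pi> (f x)))"
    by (rule defect_cong) (rule mult_left_lift(2)[OF c u f'(1)])
  then show ?thesis
    using defect_twist[OF \<theta>_maps_acting[OF f'(1)] f'(2)] c by (simp add: rel_cochains_def)
qed

text \<open>
  The comparison is relative because both maps agree with \<open>\<theta>\<close> on \<open>L\<close>.
\<close>

lemma difference_cochain:
  assumes f: "f \<in> \<theta>_maps" and g: "g \<in> \<theta>_maps"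
    and diff: "\<forall>x\<in>carrier G. g x \<otimes>\<^bsub>K\<^esub> inv\<^bsub>K\<^esub> f x \<in> H"
  shows "\<exists>c\<in>rel_cochains G L A \<rho> 1. \<forall>x\<in>carrier G. \<pi> (g x) = twist c (\<lambda>x. \<pi> (f x)) x"
proof -
  let ?c = "\<lambda>xs \<in> tuples (carrier G) 1. \<pi> (g (hd xs) \<otimes>\<^bsub>K\<^esub> inv\<^bsub>K\<^esub> f (hd xs))"
  have c: "?c [x] = \<pi> (g x \<otimes>\<^bsub>K\<^esub> inv\<^bsub>K\<^esub> f x)" if "x \<in> carrier G" for x
    using that by simp
  have cA: "?c xs \<in> carrier A" if xs: "xs \<in> tuples (carrier G) 1" for xs
  proof -
    obtain x where x: "x \<in> carrier G" and "xs = [x]"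
      using xs by (auto simp: tuples_1)
    then have "?c xs = \<pi> (g x \<otimes>\<^bsub>K\<^esub> inv\<^bsub>K\<^esub> f x)"
      using c by blast
    then show ?thesis
      using diff x unfolding carrier_A by blast
  qed
  have "?c \<in> carrier (C 1)"
    unfolding carrier_C using cA by (intro PiE_I) simp_all
  moreover have "?c [l] = \<one>\<^bsub>A\<^esub>" if "l \<in> L" for l
  proof -
    have "g l = f l" using f g that by (simp add: \<theta>_maps_def)
    then show ?thesis
      using that c[of l] L_subset \<theta>_maps_N[OF f] N_carrier by (simp add: one_A \<pi>_one)
  qed
  ultimately have "?c \<in> rel_cochains G L A \<rho> 1"
    unfolding rel_cochains_1_iff by blast
  moreover have "\<pi> (g x) = twist ?c (\<lambda>x. \<pi> (f x)) x" if x: "x \<in> carrier G" for x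
  proof -
    have "\<pi> (g x) = \<pi> ((g x \<otimes>\<^bsub>K\<^esub> inv\<^bsub>K\<^esub> f x) \<otimes>\<^bsub>K\<^esub> f x)"
      using \<theta>_maps_N[OF f x] \<theta>_maps_N[OF g x] N_carrier by (simp add: K.m_assoc)
    also have "\<dots> = twist ?c (\<lambda>x. \<pi> (f x)) x"
      using \<theta>_maps_N[OF f x] \<theta>_maps_N[OF g x] N_mult N_inv by (simp only: \<pi>_mult c[OF x])
    finally show ?thesis .
  qed
  ultimately show ?thesis
    by (intro bexI[of _ ?c] ballI)
qed

section \<open>Restriction, action and obstruction\<close>

lemma rel_cocycles_1_cochain: "\<gamma> \<in> rel_cocycles G L A \<rho> 1 \<Longrightarrow> \<gamma> \<in> rel_cochains G L A \<rho> 1"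
  by (simp add: rel_cocycles_def)

lemma rel_cocycles_1_diff: "\<gamma> \<in> rel_cocycles G L A \<rho> 1 \<Longrightarrow> d 1 \<gamma> = \<one>\<^bsub>C 2\<^esub>"
  by (simp add: rel_cocycles_def numeral_2_eq_2)

lemma mult_left_Mt:
  assumes \<gamma>: "\<gamma> \<in> rel_cocycles G L A \<rho> 1" and u: "is_lift G K H Ht \<gamma> u" and f: "f \<in> Mt"
  shows "mult_left G K u f \<in> Mt"
  using mult_left_lift(1)[OF rel_cocycles_1_cochain[OF \<gamma>] u]
    defect_mult_left[OF rel_cocycles_1_cochain[OF \<gamma>] u Mt_subset_M[OF f]]
    rel_cocycles_1_diff[OF \<gamma>] f
  by (simp add: Mt_iff)

lemma \<pi>_mult_left:
  assumes "\<gamma> \<in> rel_cocycles G L A \<rho> 1" "is_lift G K H Ht \<gamma> u" "f \<in> Mt" "x \<in> carrier G"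
  shows "\<pi> (mult_left G K u f x) = \<gamma> [x] \<otimes>\<^bsub>Q\<^esub> \<pi> (f x)"
  using mult_left_lift(2)[OF rel_cocycles_1_cochain] assms by (simp add: Mt_iff)

text \<open>
  Both defects are trivial, so by \<open>defect_twist\<close> the coboundary of the comparing cochain is.
\<close>

lemma difference_cocycle:
  assumes f: "f \<in> Mt" and g: "g \<in> Mt" and eq: "class\<^sub>H f = class\<^sub>H g"
  shows "\<exists>\<gamma>\<in>rel_cocycles G L A \<rho> 1. \<forall>x\<in>carrier G. \<pi> (g x) = \<gamma> [x] \<otimes>\<^bsub>Q\<^esub> \<pi> (f x)"
proof -
  have f': "f \<in> \<theta>_maps" "defect G Q (\<lambda>x. \<pi> (f x)) = \<one>\<^bsub>C 2\<^esub>"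
    and g': "g \<in> \<theta>_maps" "defect G Q (\<lambda>x. \<pi> (g x)) = \<one>\<^bsub>C 2\<^esub>"
    using f g by (simp_all add: Mt_iff)
  obtain c where c: "c \<in> rel_cochains G L A \<rho> 1"
    and tw: "\<forall>x\<in>carrier G. \<pi> (g x) = twist c (\<lambda>x. \<pi> (f x)) x"
    using difference_cochain[OF f'(1) g'(1)
        eq[unfolded class\<^sub>H_eq_iff[OF Mt_subset_M[OF f] Mt_subset_M[OF g]]]] by (elim bexE)
  have cC: "c \<in> carrier (C 1)" using c by (simp add: rel_cochains_def)
  have "\<one>\<^bsub>C 2\<^esub> = defect G Q (twist c (\<lambda>x. \<pi> (f x)))"
    using defect_cong[of "\<lambda>x. \<pi> (g x)", OF bspec[OF tw]] g'(2) by simp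
  also have "\<dots> = d 1 c"
    using defect_twist[OF \<theta>_maps_acting[OF f'(1)] _ cC] f'(2) d.hom_closed[OF cC]
    by (simp add: numeral_2_eq_2)
  finally have "c \<in> rel_cocycles G L A \<rho> 1"
    using c by (simp add: rel_cocycles_def numeral_2_eq_2)
  with tw show ?thesis by (intro bexI[of _ c])
qed

text \<open>
  The three maps are defined through chosen representatives and lifts; \<open>restriction_class\<close>,
  \<open>translation_class\<close> and \<open>obstruction_class\<close> show that the choices do not matter.
\<close>

definition rep\<^sub>t :: "('a \<Rightarrow> 'b) set \<Rightarrow> 'a \<Rightarrow> 'b"
  where "rep\<^sub>t e = (SOME f. f \<in> Mt \<and> class\<^sub>t f = e)"

definition rep\<^sub>H :: "('a \<Rightarrow> 'b) set \<Rightarrow> 'a \<Rightarrow> 'b"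
  where "rep\<^sub>H e = (SOME f. f \<in> M \<and> class\<^sub>H f = e)"

lemma rep\<^sub>t: "e \<in> Et \<Longrightarrow> rep\<^sub>t e \<in> Mt \<and> class\<^sub>t (rep\<^sub>t e) = e"
proof -
  assume "e \<in> Et"
  then have "\<exists>f. f \<in> Mt \<and> class\<^sub>t f = e" by (auto simp: Et)
  then show ?thesis unfolding rep\<^sub>t_def by (rule someI_ex)
qed

lemma rep\<^sub>H: "e \<in> E \<Longrightarrow> rep\<^sub>H e \<in> M \<and> class\<^sub>H (rep\<^sub>H e) = e"
proof -
  assume "e \<in> E"
  then have "\<exists>f. f \<in> M \<and> class\<^sub>H f = e" by (auto simp: E)
  then show ?thesis unfolding rep\<^sub>H_def by (rule someI_ex)
qed

definition restriction :: "('a \<Rightarrow> 'b) set \<Rightarrow> ('a \<Rightarrow> 'b) set"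
  where "restriction e = class\<^sub>H (rep\<^sub>t e)"

definition translation :: "('a list \<Rightarrow> 'b set) \<Rightarrow> ('a \<Rightarrow> 'b) set \<Rightarrow> ('a \<Rightarrow> 'b) set"
  where "translation \<gamma> =
    (\<lambda>e \<in> Et. class\<^sub>t (mult_left G K (SOME u. is_lift G K H Ht \<gamma> u) (rep\<^sub>t e)))"

definition obstruction :: "('a \<Rightarrow> 'b) set \<Rightarrow> ('a list \<Rightarrow> 'b set) set"
  where "obstruction e = rel_H_class G L A \<rho> 2 (sharp G K Ht (rep\<^sub>H e))"

lemma restriction_class:
  assumes f: "f \<in> Mt"
  shows "restriction (class\<^sub>t f) = class\<^sub>H f"
proof -
  define g where "g = rep\<^sub>t (class\<^sub>t f)"
  have g: "g \<in> Mt" and eq: "class\<^sub>t g = class\<^sub>t f"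
    using rep\<^sub>t[of "class\<^sub>t f"] f by (auto simp: g_def Et)
  have "f x \<otimes>\<^bsub>K\<^esub> inv\<^bsub>K\<^esub> g x \<in> H" if x: "x \<in> carrier G" for x
  proof -
    have mem: "f x \<in> N" "g x \<in> N" using f g \<theta>_maps_N x by (auto simp: Mt_iff)
    have "\<pi> (f x) = \<pi> (g x)" using eq class\<^sub>t_eq_iff[OF g f] x by simp
    then have "\<pi> (f x \<otimes>\<^bsub>K\<^esub> inv\<^bsub>K\<^esub> g x) = \<one>\<^bsub>Q\<^esub>"
      using mem by (simp add: \<pi>_mult \<pi>_inv N_inv)
    then show ?thesis
      using \<pi>_eq_one_iff[OF N_mult[OF mem(1) N_inv[OF mem(2)]]] Ht_H by simp
  qed
  then have "class\<^sub>H g = class\<^sub>H f"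
    using class\<^sub>H_eq_iff[OF Mt_subset_M[OF g] Mt_subset_M[OF f]] by simp
  then show ?thesis by (simp add: restriction_def g_def)
qed

lemma restriction_closed: "restriction \<in> Et \<rightarrow> E"
proof (rule Pi_I)
  fix e assume "e \<in> Et"
  then have "rep\<^sub>t e \<in> M" using rep\<^sub>t Mt_subset_M by blast
  then show "restriction e \<in> E" unfolding restriction_def E by (rule imageI)
qed

lemma translation_class:
  assumes \<gamma>: "\<gamma> \<in> rel_cocycles G L A \<rho> 1" and f: "f \<in> Mt" and u: "is_lift G K H Ht \<gamma> u"
  shows "translation \<gamma> (class\<^sub>t f) = class\<^sub>t (mult_left G K u f)"
proof -
  define g where "g = rep\<^sub>t (class\<^sub>t f)"
  have g: "g \<in> Mt" and eq: "class\<^sub>t g = class\<^sub>t f"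
    using rep\<^sub>t[of "class\<^sub>t f"] f by (auto simp: g_def Et)
  define v where "v = (SOME u. is_lift G K H Ht \<gamma> u)"
  have v: "is_lift G K H Ht \<gamma> v"
    unfolding v_def using someI[of "is_lift G K H Ht \<gamma>" u] u by simp
  have "class\<^sub>t (mult_left G K v g) = class\<^sub>t (mult_left G K u f)"
    using eq class\<^sub>t_eq_iff[OF g f]
    by (simp add: class\<^sub>t_eq_iff mult_left_Mt[OF \<gamma> v g] mult_left_Mt[OF \<gamma> u f]
        \<pi>_mult_left[OF \<gamma> v g] \<pi>_mult_left[OF \<gamma> u f])
  moreover have "class\<^sub>t f \<in> Et" using f by (simp add: Et)
  ultimately show ?thesis
    by (simp add: translation_def v_def g_def)
qed

text \<open>
  In \<open>Q\<close> the action is left multiplication by the values of the cocycle. All properties of the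
  action follow from this pointwise form.
\<close>

lemma translation_eq_iff:
  assumes \<gamma>: "\<gamma> \<in> rel_cocycles G L A \<rho> 1" and f: "f \<in> Mt" and g: "g \<in> Mt"
  shows "translation \<gamma> (class\<^sub>t f) = class\<^sub>t g \<longleftrightarrow>
    (\<forall>x\<in>carrier G. \<pi> (g x) = \<gamma> [x] \<otimes>\<^bsub>Q\<^esub> \<pi> (f x))"
proof -
  obtain u where u: "is_lift G K H Ht \<gamma> u"
    using lift_exists[OF rel_cocycles_1_cochain[OF \<gamma>]] by blast
  show ?thesis
    unfolding translation_class[OF \<gamma> f u] class\<^sub>t_eq_iff[OF mult_left_Mt[OF \<gamma> u f] g]
    using \<pi>_mult_left[OF \<gamma> u f] by auto
qed

lemma translation_closed:
  assumes \<gamma>: "\<gamma> \<in> rel_cocycles G L A \<rho> 1" and e: "e \<in> Et"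
  shows "translation \<gamma> e \<in> Et"
proof -
  obtain u where u: "is_lift G K H Ht \<gamma> u"
    using lift_exists[OF rel_cocycles_1_cochain[OF \<gamma>]] by blast
  obtain f where "f \<in> Mt" "e = class\<^sub>t f" using e by (auto simp: Et)
  then show ?thesis
    using translation_class[OF \<gamma> _ u] mult_left_Mt[OF \<gamma> u] by (auto simp: Et)
qed

lemma cocycle_value:
  "\<gamma> \<in> rel_cocycles G L A \<rho> 1 \<Longrightarrow> x \<in> carrier G \<Longrightarrow> \<gamma> [x] \<in> carrier A"
  by (auto simp: rel_cocycles_def rel_cochains_def C_closed)

lemma \<pi>_Mt_closed: "f \<in> Mt \<Longrightarrow> x \<in> carrier G \<Longrightarrow> \<pi> (f x) \<in> carrier Q"
  using \<theta>_maps_N by (auto simp: Mt_iff)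

text \<open>
  The action laws are the group laws of \<open>Q\<close> applied pointwise, and a cocycle that fixes one class
  is trivial by cancellation.
\<close>

lemma free_action_translation: "free_action (rel_Z G L A \<rho> 1) Et translation"
proof -
  let ?Z = "rel_cocycles G L A \<rho> 1" and ?i = "\<lambda>\<gamma>. inv\<^bsub>rel_Z G L A \<rho> 1\<^esub> \<gamma>"
  interpret Z: comm_group "rel_Z G L A \<rho> 1" by (rule comm_group_Z)
  have mult_closed: "\<gamma> \<otimes>\<^bsub>C 1\<^esub> \<delta> \<in> ?Z" if "\<gamma> \<in> ?Z" "\<delta> \<in> ?Z" for \<gamma> \<delta>
    using subgroup.m_closed[OF rel_cocycles_subgroup] that by blast
  have mult_apply: "(\<gamma> \<otimes>\<^bsub>C 1\<^esub> \<delta>) [x] = \<gamma> [x] \<otimes>\<^bsub>Q\<^esub> \<delta> [x]" if "x \<in> carrier G" for \<gamma> \<delta> x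
    using that by (simp add: mult_C mult_A)
  have one_closed: "\<one>\<^bsub>C 1\<^esub> \<in> ?Z"
    using subgroup.one_closed[OF rel_cocycles_subgroup] by blast
  have one_apply: "\<one>\<^bsub>C 1\<^esub> [x] = \<one>\<^bsub>Q\<^esub>" if "x \<in> carrier G" for x
    using that by (simp add: one_C one_A)
  have one: "translation \<one>\<^bsub>C 1\<^esub> e = e" if "e \<in> Et" for e
    using that translation_eq_iff[OF one_closed] one_apply \<pi>_Mt_closed
    by (auto simp: Et)
  have comp: "translation (\<gamma> \<otimes>\<^bsub>C 1\<^esub> \<delta>) e = translation \<gamma> (translation \<delta> e)"
    if \<gamma>: "\<gamma> \<in> ?Z" and \<delta>: "\<delta> \<in> ?Z" and e: "e \<in> Et" for \<gamma> \<delta> e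
  proof -
    obtain f where f: "f \<in> Mt" "e = class\<^sub>t f" using e by (auto simp: Et)
    obtain g where g: "g \<in> Mt" "translation \<delta> e = class\<^sub>t g"
      using translation_closed[OF \<delta> e] by (auto simp: Et)
    obtain k where k: "k \<in> Mt" "translation \<gamma> (class\<^sub>t g) = class\<^sub>t k"
      using translation_closed[OF \<gamma>, of "class\<^sub>t g"] g by (auto simp: Et)
    have "\<pi> (k x) = (\<gamma> \<otimes>\<^bsub>C 1\<^esub> \<delta>) [x] \<otimes>\<^bsub>Q\<^esub> \<pi> (f x)" if x: "x \<in> carrier G" for x
      unfolding mult_apply[OF x]
      using translation_eq_iff[OF \<gamma> g(1) k(1)] translation_eq_iff[OF \<delta> f(1) g(1)] f(2) g(2) k(2) x
        cocycle_value[OF \<gamma> x] cocycle_value[OF \<delta> x] \<pi>_Mt_closed[OF f(1) x]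
      by (simp add: Q.m_assoc)
    then show ?thesis
      using translation_eq_iff[OF mult_closed[OF \<gamma> \<delta>] f(1) k(1)] f g k by simp
  qed
  have inv: "?i \<gamma> \<in> ?Z" if "\<gamma> \<in> ?Z" for \<gamma>
    using Z.inv_closed[of \<gamma>] that unfolding carrier_Z .
  have inv_mult: "?i \<gamma> \<otimes>\<^bsub>C 1\<^esub> \<gamma> = \<one>\<^bsub>C 1\<^esub>" "\<gamma> \<otimes>\<^bsub>C 1\<^esub> ?i \<gamma> = \<one>\<^bsub>C 1\<^esub>" if "\<gamma> \<in> ?Z" for \<gamma>
    using Z.l_inv[of \<gamma>] Z.r_inv[of \<gamma>] that unfolding carrier_Z mult_Z one_Z by blast+
  have Bij: "translation \<gamma> \<in> Bij Et" if \<gamma>: "\<gamma> \<in> ?Z" for \<gamma>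
  proof -
    have "bij_betw (translation \<gamma>) Et Et"
    proof (rule bij_betw_byWitness[where f' = "translation (?i \<gamma>)"])
      show "\<forall>e\<in>Et. translation (?i \<gamma>) (translation \<gamma> e) = e"
        using comp[OF inv[OF \<gamma>] \<gamma>] one inv_mult(1)[OF \<gamma>] by simp
      show "\<forall>e\<in>Et. translation \<gamma> (translation (?i \<gamma>) e) = e"
        using comp[OF \<gamma> inv[OF \<gamma>]] one inv_mult(2)[OF \<gamma>] by simp
    qed (use translation_closed \<gamma> inv in auto)
    then show ?thesis by (simp add: Bij_def translation_def)
  qed
  have "translation \<in> hom (rel_Z G L A \<rho> 1) (BijGroup Et)"
  proof (rule homI)
    fix \<gamma> \<delta> assume "\<gamma> \<in> carrier (rel_Z G L A \<rho> 1)" "\<delta> \<in> carrier (rel_Z G L A \<rho> 1)"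
    then have \<gamma>: "\<gamma> \<in> ?Z" and \<delta>: "\<delta> \<in> ?Z" by (simp_all add: carrier_Z)
    have "translation (\<gamma> \<otimes>\<^bsub>C 1\<^esub> \<delta>) = compose Et (translation \<gamma>) (translation \<delta>)"
      using comp[OF \<gamma> \<delta>] Bij[OF mult_closed[OF \<gamma> \<delta>]]
      by (intro extensionalityI[of _ Et])
        (auto simp: Bij_imp_extensional compose_eq compose_extensional)
    then show "translation (\<gamma> \<otimes>\<^bsub>rel_Z G L A \<rho> 1\<^esub> \<delta>) =
        translation \<gamma> \<otimes>\<^bsub>BijGroup Et\<^esub> translation \<delta>"
      using Bij \<gamma> \<delta> by (simp add: BijGroup_def mult_Z)
  qed (simp add: carrier_Z BijGroup_def Bij)
  then have "group_action (rel_Z G L A \<rho> 1) Et translation"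
    by (intro group_action.intro group_hom.intro group_hom_axioms.intro Z.is_group group_BijGroup)
  moreover have "stabilizer (rel_Z G L A \<rho> 1) translation e = {\<one>\<^bsub>rel_Z G L A \<rho> 1\<^esub>}" if e: "e \<in> Et" for e
  proof -
    obtain f where f: "f \<in> Mt" "e = class\<^sub>t f" using e by (auto simp: Et)
    have "\<gamma> = \<one>\<^bsub>C 1\<^esub>" if \<gamma>: "\<gamma> \<in> ?Z" and fixed: "translation \<gamma> e = e" for \<gamma>
    proof (rule C_eqI)
      show "\<gamma> \<in> carrier (C 1)" "\<one>\<^bsub>C 1\<^esub> \<in> carrier (C 1)"
        using \<gamma> one_closed by (simp_all add: rel_cocycles_def rel_cochains_def)
      fix xs assume "xs \<in> tuples (carrier G) 1"
      then obtain x where xs: "xs = [x]" and x: "x \<in> carrier G" by (auto simp: tuples_1)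
      have "\<pi> (f x) = \<gamma> [x] \<otimes>\<^bsub>Q\<^esub> \<pi> (f x)"
        using translation_eq_iff[OF \<gamma> f(1) f(1)] fixed f(2) x by simp
      then have "\<gamma> [x] = \<one>\<^bsub>Q\<^esub>"
        using Q.r_cancel_one[of "\<pi> (f x)" "\<gamma> [x]"] \<pi>_Mt_closed[OF f(1) x] cocycle_value[OF \<gamma> x]
        by simp
      then show "\<gamma> xs = \<one>\<^bsub>C 1\<^esub> xs"
        using one_apply[OF x] xs by simp
    qed
    then show ?thesis
      using one[OF e] one_closed unfolding stabilizer_def carrier_Z one_Z by blast
  qed
  ultimately show ?thesis by (simp add: free_action_def)
qed

text \<open>
  If two classes have the same restriction, they differ by a cocycle (\<open>difference_cocycle\<close>);
  conversely the lift of a cocycle has values in \<open>H\<close>, so it does not change the class modulo \<open>H\<close>.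
\<close>

lemma quotient_map_restriction:
  "quotient_map_by_action (rel_Z G L A \<rho> 1) translation Et (restriction ` Et) restriction"
  unfolding quotient_map_by_action_def
proof (intro conjI ballI refl)
  fix e e' assume "e \<in> Et" "e' \<in> Et"
  then obtain f g where f: "f \<in> Mt" "e = class\<^sub>t f" and g: "g \<in> Mt" "e' = class\<^sub>t g"
    by (auto simp: Et)
  have "class\<^sub>H f = class\<^sub>H g \<longleftrightarrow> (\<exists>\<gamma>\<in>rel_cocycles G L A \<rho> 1. class\<^sub>t g = translation \<gamma> (class\<^sub>t f))"
  proof
    assume "class\<^sub>H f = class\<^sub>H g"
    then show "\<exists>\<gamma>\<in>rel_cocycles G L A \<rho> 1. class\<^sub>t g = translation \<gamma> (class\<^sub>t f)"
      using difference_cocycle[OF f(1) g(1)] translation_eq_iff[OF _ f(1) g(1)] by (auto simp: eq_commute)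
  next
    assume "\<exists>\<gamma>\<in>rel_cocycles G L A \<rho> 1. class\<^sub>t g = translation \<gamma> (class\<^sub>t f)"
    then obtain \<gamma> where \<gamma>: "\<gamma> \<in> rel_cocycles G L A \<rho> 1"
      and eq: "class\<^sub>t g = translation \<gamma> (class\<^sub>t f)" by blast
    obtain u where u: "is_lift G K H Ht \<gamma> u"
      using lift_exists[OF rel_cocycles_1_cochain[OF \<gamma>]] by blast
    have k: "mult_left G K u f \<in> Mt" using mult_left_Mt[OF \<gamma> u f(1)] .
    have "mult_left G K u f x \<otimes>\<^bsub>K\<^esub> inv\<^bsub>K\<^esub> f x \<in> H" if x: "x \<in> carrier G" for x
    proof -
      have "u x \<in> H" using lift_properties(1)[OF rel_cocycles_1_cochain[OF \<gamma>] u x] .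
      then show ?thesis
        using x f(1) \<theta>_maps_N[of f x] N_carrier H_N
        by (simp add: mult_left_apply Mt_iff K.m_assoc)
    qed
    then have "class\<^sub>H f = class\<^sub>H (mult_left G K u f)"
      using class\<^sub>H_eq_iff[OF Mt_subset_M[OF f(1)] Mt_subset_M[OF k]] by simp
    also have "\<dots> = restriction (class\<^sub>t g)"
      using restriction_class[OF k] eq translation_class[OF \<gamma> f(1) u] by simp
    finally show "class\<^sub>H f = class\<^sub>H g"
      using restriction_class[OF g(1)] by simp
  qed
  then show "restriction e = restriction e' \<longleftrightarrow> e' \<in> orbit (rel_Z G L A \<rho> 1) translation e"
    using restriction_class f g by (auto simp: orbit_def rel_Z_def)
qed

text \<open>
  The cocycle identity is \<open>defect_cocycle\<close>; the cocycle is relative since \<open>f\<close> agrees with the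
  homomorphism \<open>\<theta>\<close> on \<open>L\<close>.
\<close>

lemma sharp_cocycle:
  assumes "f \<in> M"
  shows "sharp G K Ht f \<in> rel_cocycles G L A \<rho> 2"
proof -
  have f: "f \<in> \<theta>_maps" and D: "defect G Q (\<lambda>x. \<pi> (f x)) \<in> carrier (C 2)"
    using assms by (simp_all add: M_iff)
  have "defect G Q (\<lambda>x. \<pi> (f x)) [l, m] = \<one>\<^bsub>A\<^esub>" if l: "l \<in> L" and m: "m \<in> L" for l m
  proof -
    have "f l \<otimes>\<^bsub>K\<^esub> f m = f (l \<otimes>\<^bsub>G\<^esub> m)"
      using f l m hom_mult[OF \<theta>_hom, of l m] subgroup.m_closed[OF subgroup_L l m]
      by (simp add: \<theta>_maps_def)
    then have "\<pi> (f l) \<otimes>\<^bsub>Q\<^esub> \<pi> (f m) = \<pi> (f (l \<otimes>\<^bsub>G\<^esub> m))"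
      using \<pi>_mult[of "f l" "f m"] \<theta>_maps_N[OF f] l m L_subset by simp
    then show ?thesis
      using l m L_subset \<theta>_maps_N[OF f]
      by (simp add: defect_pair one_A)
  qed
  then show ?thesis
    using D defect_cocycle[OF \<theta>_maps_acting[OF f] D]
    unfolding sharp_eq_defect[OF f] rel_cocycles_def mem_Collect_eq rel_cochains_2_iff
    by (auto simp: numeral_3_eq_3)
qed

text \<open>
  Another representative differs from \<open>f\<close> by a relative cochain \<open>c\<close>, which changes the defect by
  the relative coboundary \<open>d c\<close>.
\<close>

lemma obstruction_class:
  assumes f: "f \<in> M"
  shows "obstruction (class\<^sub>H f) = rel_H_class G L A \<rho> 2 (sharp G K Ht f)"
proof -
  define g where "g = rep\<^sub>H (class\<^sub>H f)"
  have g: "g \<in> M" and eq: "class\<^sub>H f = class\<^sub>H g"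
    using rep\<^sub>H[of "class\<^sub>H f"] f by (auto simp: g_def E)
  have f': "f \<in> \<theta>_maps" "defect G Q (\<lambda>x. \<pi> (f x)) \<in> carrier (C 2)"
    and g': "g \<in> \<theta>_maps" "defect G Q (\<lambda>x. \<pi> (g x)) \<in> carrier (C 2)"
    using f g by (simp_all add: M_iff)
  obtain c where c: "c \<in> rel_cochains G L A \<rho> 1"
    and tw: "\<forall>x\<in>carrier G. \<pi> (g x) = twist c (\<lambda>x. \<pi> (f x)) x"
    using difference_cochain[OF f'(1) g'(1) eq[unfolded class\<^sub>H_eq_iff[OF f g]]] by (elim bexE)
  have cC: "c \<in> carrier (C 1)" using c by (simp add: rel_cochains_def)
  have dc: "d 1 c \<in> carrier (C 2)" using d.hom_closed[OF cC] by (simp add: numeral_2_eq_2)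
  have "defect G Q (\<lambda>x. \<pi> (g x)) = defect G Q (twist c (\<lambda>x. \<pi> (f x)))"
    by (rule defect_cong) (rule bspec[OF tw])
  also have "\<dots> = d 1 c \<otimes>\<^bsub>C 2\<^esub> defect G Q (\<lambda>x. \<pi> (f x))"
    by (rule defect_twist[OF \<theta>_maps_acting[OF f'(1)] f'(2) cC])
  finally have "sharp G K Ht g \<otimes>\<^bsub>C 2\<^esub> inv\<^bsub>C 2\<^esub> sharp G K Ht f = d 1 c"
    using f' g' dc by (simp add: sharp_eq_defect C.m_assoc)
  moreover have "d 1 c \<in> rel_coboundaries G L A \<rho> 2"
    using c by (auto simp: rel_coboundaries_def numeral_2_eq_2)
  ultimately have "rel_H_class G L A \<rho> 2 (sharp G K Ht g) = rel_H_class G L A \<rho> 2 (sharp G K Ht f)"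
    using f' g' by (simp add: rel_H_class_eq_iff sharp_eq_defect)
  then show ?thesis by (simp add: obstruction_def g_def)
qed

lemma obstruction_closed: "obstruction \<in> E \<rightarrow> carrier (rel_H G L A \<rho> 2)"
  using obstruction_class rel_H_class_closed[OF sharp_cocycle] by (auto simp: E)

lemma image_restriction: "restriction ` Et = class\<^sub>H ` Mt"
  using restriction_class by (auto simp: Et image_image)

text \<open>
  If the defect of \<open>f\<close> is a coboundary \<open>d b\<close>, multiplying \<open>f\<close> by a lift of \<open>b\<^sup>-\<^sup>1\<close> removes it
  without leaving the class of \<open>f\<close> modulo \<open>H\<close>.
\<close>

lemma exactness: "restriction ` Et = {e \<in> E. obstruction e = \<one>\<^bsub>rel_H G L A \<rho> 2\<^esub>}"
proof (intro subset_antisym subsetI)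
  fix e assume "e \<in> restriction ` Et"
  then obtain f where f: "f \<in> Mt" and e: "e = class\<^sub>H f"
    by (auto simp: image_restriction)
  have "sharp G K Ht f = \<one>\<^bsub>C 2\<^esub>"
    using f sharp_eq_defect by (simp add: Mt_iff)
  then have "obstruction e = \<one>\<^bsub>rel_H G L A \<rho> 2\<^esub>"
    using obstruction_class[OF Mt_subset_M[OF f]] rel_H_class_one[OF C.one_closed]
      subgroup.one_closed[OF rel_coboundaries_subgroup] e by simp
  then show "e \<in> {e \<in> E. obstruction e = \<one>\<^bsub>rel_H G L A \<rho> 2\<^esub>}"
    using Mt_subset_M[OF f] e by (auto simp: E)
next
  fix e assume "e \<in> {e \<in> E. obstruction e = \<one>\<^bsub>rel_H G L A \<rho> 2\<^esub>}"
  then obtain f where f: "f \<in> M" and e: "e = class\<^sub>H f"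
    and triv: "obstruction (class\<^sub>H f) = \<one>\<^bsub>rel_H G L A \<rho> 2\<^esub>"
    by (auto simp: E)
  have f': "f \<in> \<theta>_maps" and D: "defect G Q (\<lambda>x. \<pi> (f x)) \<in> carrier (C 2)"
    using f by (simp_all add: M_iff)
  have "defect G Q (\<lambda>x. \<pi> (f x)) \<in> rel_coboundaries G L A \<rho> 2"
    using triv rel_H_class_one[OF D] obstruction_class[OF f] sharp_eq_defect[OF f'] by simp
  then obtain b where b: "b \<in> rel_cochains G L A \<rho> 1" and Db: "defect G Q (\<lambda>x. \<pi> (f x)) = d 1 b"
    by (auto simp: rel_coboundaries_def numeral_2_eq_2)
  let ?c = "inv\<^bsub>C 1\<^esub> b"
  have bC: "b \<in> carrier (C 1)" using b by (simp add: rel_cochains_def)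
  have c: "?c \<in> rel_cochains G L A \<rho> 1"
    using subgroup.m_inv_closed[OF rel_cochains_subgroup b] .
  obtain u where u: "is_lift G K H Ht ?c u" using lift_exists[OF c] by blast
  let ?g = "mult_left G K u f"
  have "d 1 ?c = inv\<^bsub>C 2\<^esub> d 1 b"
    using d.hom_inv[OF bC] by (simp add: numeral_2_eq_2)
  then have "defect G Q (\<lambda>x. \<pi> (?g x)) = \<one>\<^bsub>C 2\<^esub>"
    using defect_mult_left[OF c u f] D Db by simp
  then have g: "?g \<in> Mt"
    using mult_left_lift(1)[OF c u f'] by (simp add: Mt_iff)
  have "?g x \<otimes>\<^bsub>K\<^esub> inv\<^bsub>K\<^esub> f x \<in> H" if x: "x \<in> carrier G" for x
    using lift_properties(1)[OF c u x] x \<theta>_maps_N[OF f' x] N_carrier H_N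
    by (simp add: mult_left_apply K.m_assoc)
  then have "class\<^sub>H f = class\<^sub>H ?g"
    using class\<^sub>H_eq_iff[OF f Mt_subset_M[OF g]] by simp
  then show "e \<in> restriction ` Et"
    using e g by (auto simp: image_restriction)
qed

section \<open>Coboundaries and conjugation\<close>

text \<open>
  The 0-cochains are the elements \<open>h Ht\<close> of \<open>A\<close>. Such an element is fixed by \<open>L\<close> if and only if the
  commutators of \<open>f(L)\<close> with \<open>h\<close> lie in \<open>Ht\<close>, and twisting by its coboundary is conjugation by
  \<open>h\<^sup>-\<^sup>1\<close> modulo \<open>Ht\<close>.
\<close>

lemma coboundary_orbit:
  assumes f: "f \<in> Mt" and g: "g \<in> Mt"
  shows "class\<^sub>t g \<in> orbit (rel_B G L A \<rho> 1) translation (class\<^sub>t f) \<longleftrightarrow>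
    (\<exists>h\<in>H. {f l \<otimes>\<^bsub>K\<^esub> h \<otimes>\<^bsub>K\<^esub> inv\<^bsub>K\<^esub> f l \<otimes>\<^bsub>K\<^esub> inv\<^bsub>K\<^esub> h | l. l \<in> L} \<subseteq> Ht \<and>
      (\<forall>x\<in>carrier G. \<pi> (f x) = \<pi> (h \<otimes>\<^bsub>K\<^esub> g x \<otimes>\<^bsub>K\<^esub> inv\<^bsub>K\<^esub> h)))"
    (is "?orb \<longleftrightarrow> (\<exists>h\<in>H. ?comm h \<and> ?conj h)")
proof -
  have F: "(\<lambda>x. \<pi> (f x)) \<in> acting_maps" using f by (simp add: Mt_iff \<theta>_maps_acting)
  have fN: "f x \<in> N" if "x \<in> carrier G" for x using f \<theta>_maps_N that by (simp add: Mt_iff)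
  have gN: "g x \<in> N" if "x \<in> carrier G" for x using g \<theta>_maps_N that by (simp add: Mt_iff)
  let ?\<mu> = "\<lambda>h. \<lambda>xs \<in> tuples (carrier G) 0. \<pi> h"
  have \<mu>C: "?\<mu> h \<in> carrier (C 0)" if "h \<in> H" for h
    unfolding carrier_C using that by (auto simp: carrier_A)
  have inv_iff: "?\<mu> h \<in> rel_cochains G L A \<rho> 0 \<longleftrightarrow> ?comm h" if h: "h \<in> H" for h
  proof -
    have "\<rho> l (\<pi> h) = \<pi> h \<longleftrightarrow> f l \<otimes>\<^bsub>K\<^esub> h \<otimes>\<^bsub>K\<^esub> inv\<^bsub>K\<^esub> f l \<otimes>\<^bsub>K\<^esub> inv\<^bsub>K\<^esub> h \<in> Ht"
      if l: "l \<in> L" for l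
    proof -
      have mem: "f l \<in> N" "h \<in> N" using fN L_subset l h H_N by auto
      have "\<rho> l (\<pi> h) = \<pi> (f l \<otimes>\<^bsub>K\<^esub> h \<otimes>\<^bsub>K\<^esub> inv\<^bsub>K\<^esub> f l)"
        using acting_conj[OF F L_subset[OF l], of "\<pi> h"] mem h
        by (simp add: carrier_A \<pi>_mult \<pi>_inv N_mult N_inv)
      then have "\<rho> l (\<pi> h) = \<pi> h \<longleftrightarrow> \<pi> (f l \<otimes>\<^bsub>K\<^esub> h \<otimes>\<^bsub>K\<^esub> inv\<^bsub>K\<^esub> f l) \<otimes>\<^bsub>Q\<^esub> inv\<^bsub>Q\<^esub> \<pi> h = \<one>\<^bsub>Q\<^esub>"
        using mem Q.inv_solve_right[of "\<one>\<^bsub>Q\<^esub>" "\<pi> (f l \<otimes>\<^bsub>K\<^esub> h \<otimes>\<^bsub>K\<^esub> inv\<^bsub>K\<^esub> f l)" "\<pi> h"]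
        by (auto simp: N_mult N_inv)
      also have "\<dots> \<longleftrightarrow> \<pi> (f l \<otimes>\<^bsub>K\<^esub> h \<otimes>\<^bsub>K\<^esub> inv\<^bsub>K\<^esub> f l \<otimes>\<^bsub>K\<^esub> inv\<^bsub>K\<^esub> h) = \<one>\<^bsub>Q\<^esub>"
        using mem by (simp add: \<pi>_mult \<pi>_inv N_mult N_inv)
      also have "\<dots> \<longleftrightarrow> f l \<otimes>\<^bsub>K\<^esub> h \<otimes>\<^bsub>K\<^esub> inv\<^bsub>K\<^esub> f l \<otimes>\<^bsub>K\<^esub> inv\<^bsub>K\<^esub> h \<in> Ht"
        using mem by (intro \<pi>_eq_one_iff) (simp add: N_mult N_inv)
      finally show ?thesis .
    qed
    then show ?thesis
      using \<mu>C[OF h] by (auto simp: rel_cochains_def)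
  qed
  have conj_iff: "translation (d 0 (?\<mu> h)) (class\<^sub>t f) = class\<^sub>t g \<longleftrightarrow> ?conj h"
    if h: "h \<in> H" and \<gamma>: "d 0 (?\<mu> h) \<in> rel_cocycles G L A \<rho> 1" for h
  proof -
    have "\<pi> (g x) = d 0 (?\<mu> h) [x] \<otimes>\<^bsub>Q\<^esub> \<pi> (f x) \<longleftrightarrow> \<pi> (f x) = \<pi> (h \<otimes>\<^bsub>K\<^esub> g x \<otimes>\<^bsub>K\<^esub> inv\<^bsub>K\<^esub> h)"
      if x: "x \<in> carrier G" for x
    proof -
      have mem: "f x \<in> N" "g x \<in> N" "h \<in> N" using fN gN x h H_N by auto
      have memQ: "\<pi> (f x) \<in> carrier Q" "\<pi> (g x) \<in> carrier Q" "\<pi> h \<in> carrier Q"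
        using mem by auto
      have "d 0 (?\<mu> h) [x] \<otimes>\<^bsub>Q\<^esub> \<pi> (f x) = inv\<^bsub>Q\<^esub> \<pi> h \<otimes>\<^bsub>Q\<^esub> (\<pi> (f x) \<otimes>\<^bsub>Q\<^esub> \<pi> h)"
        using twist_coboundary[OF F \<mu>C[OF h] x] memQ by (simp add: Q.m_assoc)
      then have "\<pi> (g x) = d 0 (?\<mu> h) [x] \<otimes>\<^bsub>Q\<^esub> \<pi> (f x) \<longleftrightarrow>
          \<pi> h \<otimes>\<^bsub>Q\<^esub> \<pi> (g x) = \<pi> (f x) \<otimes>\<^bsub>Q\<^esub> \<pi> h"
        using memQ Q.inv_solve_left[of "\<pi> (g x)" "\<pi> h" "\<pi> (f x) \<otimes>\<^bsub>Q\<^esub> \<pi> h"] by auto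
      also have "\<dots> \<longleftrightarrow> \<pi> (f x) = \<pi> h \<otimes>\<^bsub>Q\<^esub> \<pi> (g x) \<otimes>\<^bsub>Q\<^esub> inv\<^bsub>Q\<^esub> \<pi> h"
        using memQ Q.inv_solve_right[of "\<pi> (f x)" "\<pi> h \<otimes>\<^bsub>Q\<^esub> \<pi> (g x)" "\<pi> h"] by auto
      also have "\<pi> h \<otimes>\<^bsub>Q\<^esub> \<pi> (g x) \<otimes>\<^bsub>Q\<^esub> inv\<^bsub>Q\<^esub> \<pi> h = \<pi> (h \<otimes>\<^bsub>K\<^esub> g x \<otimes>\<^bsub>K\<^esub> inv\<^bsub>K\<^esub> h)"
        using mem by (simp add: \<pi>_mult \<pi>_inv N_mult N_inv)
      finally show ?thesis .
    qed
    then show ?thesis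
      using translation_eq_iff[OF \<gamma> f g] by simp
  qed
  have cobound: "d 0 \<mu> \<in> rel_coboundaries G L A \<rho> 1" if "\<mu> \<in> rel_cochains G L A \<rho> 0" for \<mu>
    using that by (auto simp: rel_coboundaries_def)
  have B: "rel_coboundaries G L A \<rho> 1 = {d 0 (?\<mu> h) | h. h \<in> H \<and> ?comm h}"
  proof (intro subset_antisym subsetI)
    fix \<gamma> assume "\<gamma> \<in> rel_coboundaries G L A \<rho> 1"
    then obtain \<mu> where \<mu>: "\<mu> \<in> rel_cochains G L A \<rho> 0" and \<gamma>: "\<gamma> = d 0 \<mu>"
      by (auto simp: rel_coboundaries_def)
    have "\<mu> [] \<in> carrier A" using \<mu> by (auto simp: rel_cochains_def C_closed)
    then obtain h where h: "h \<in> H" "\<mu> [] = \<pi> h" by (auto simp: carrier_A)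
    have "\<mu> = ?\<mu> h"
      using \<mu> h \<mu>C[OF h(1)] by (intro C_eqI[of _ 0]) (auto simp: rel_cochains_def)
    then show "\<gamma> \<in> {d 0 (?\<mu> h) | h. h \<in> H \<and> ?comm h}"
      using \<gamma> h(1) \<mu> inv_iff[OF h(1)] by blast
  next
    fix \<gamma> assume "\<gamma> \<in> {d 0 (?\<mu> h) | h. h \<in> H \<and> ?comm h}"
    then obtain h where "h \<in> H" "?comm h" "\<gamma> = d 0 (?\<mu> h)" by blast
    then show "\<gamma> \<in> rel_coboundaries G L A \<rho> 1"
      using inv_iff cobound by blast
  qed
  have "?orb \<longleftrightarrow> (\<exists>\<gamma>\<in>rel_coboundaries G L A \<rho> 1. translation \<gamma> (class\<^sub>t f) = class\<^sub>t g)"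
    by (auto simp: orbit_def rel_B_def)
  also have "\<dots> \<longleftrightarrow> (\<exists>h\<in>H. ?comm h \<and> translation (d 0 (?\<mu> h)) (class\<^sub>t f) = class\<^sub>t g)"
    unfolding B by blast
  also have "\<dots> \<longleftrightarrow> (\<exists>h\<in>H. ?comm h \<and> ?conj h)"
  proof (intro bex_cong refl conj_cong)
    fix h assume h: "h \<in> H" and "?comm h"
    then have "d 0 (?\<mu> h) \<in> rel_cocycles G L A \<rho> 1"
      using inv_iff cobound rel_B1_subset_Z1 by blast
    then show "translation (d 0 (?\<mu> h)) (class\<^sub>t f) = class\<^sub>t g \<longleftrightarrow> ?conj h"
      by (rule conj_iff[OF h])
  qed
  finally show ?thesis .
qed

text \<open>
  Conjugation by an element of \<open>N\<close> is an automorphism of \<open>K\<close> that induces one of \<open>Q\<close>.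
\<close>

lemma conjugate_weak_morph:
  assumes h: "h \<in> N" and g: "g \<in> weak_morphs G L KN Ht"
  shows "(\<lambda>x \<in> carrier G. h \<otimes>\<^bsub>K\<^esub> g x \<otimes>\<^bsub>K\<^esub> inv\<^bsub>K\<^esub> h) \<in> weak_morphs G L KN Ht" (is "?f \<in> _")
proof -
  have gN: "g x \<in> N" if "x \<in> carrier G" for x
    using g that by (auto simp: weak_morphs_Ht_iff)
  have g_mult: "g (l \<otimes>\<^bsub>G\<^esub> m) = g l \<otimes>\<^bsub>K\<^esub> g m" if "l \<in> L" "m \<in> L" for l m
    using g that by (auto simp: weak_morphs_Ht_iff hom_def)
  have conj_mult: "h \<otimes>\<^bsub>K\<^esub> a \<otimes>\<^bsub>K\<^esub> inv\<^bsub>K\<^esub> h \<otimes>\<^bsub>K\<^esub> (h \<otimes>\<^bsub>K\<^esub> b \<otimes>\<^bsub>K\<^esub> inv\<^bsub>K\<^esub> h)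
      = h \<otimes>\<^bsub>K\<^esub> (a \<otimes>\<^bsub>K\<^esub> b) \<otimes>\<^bsub>K\<^esub> inv\<^bsub>K\<^esub> h" if "a \<in> N" "b \<in> N" for a b
  proof -
    have "inv\<^bsub>K\<^esub> h \<otimes>\<^bsub>K\<^esub> (h \<otimes>\<^bsub>K\<^esub> c) = c" if "c \<in> carrier K" for c
      using N_carrier[OF h] that by (simp flip: K.m_assoc)
    then show ?thesis
      using N_carrier[OF h] N_carrier[OF that(1)] N_carrier[OF that(2)] by (simp add: K.m_assoc)
  qed
  have f: "?f \<in> carrier G \<rightarrow>\<^sub>E N"
    using gN h N_mult N_inv by auto
  have "?f \<in> hom (G\<lparr>carrier := L\<rparr>) KN"
    using f L_subset gN g_mult conj_mult subgroup.m_closed[OF subgroup_L]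
    by (auto simp: hom_def)
  moreover have "\<pi> (?f x) \<otimes>\<^bsub>Q\<^esub> \<pi> (?f y) = \<pi> (?f (x \<otimes>\<^bsub>G\<^esub> y))"
    if x: "x \<in> carrier G" and y: "y \<in> carrier G" for x y
  proof -
    have "(\<lambda>x. \<pi> (g x)) \<in> carrier G \<rightarrow> carrier Q" using gN by auto
    then have "\<pi> (g x) \<otimes>\<^bsub>Q\<^esub> \<pi> (g y) = \<pi> (g (x \<otimes>\<^bsub>G\<^esub> y))"
      using g x y defect_one_iff by (simp add: weak_morphs_Ht_iff)
    moreover have "\<pi> (?f x) \<otimes>\<^bsub>Q\<^esub> \<pi> (?f y) = \<pi> (h \<otimes>\<^bsub>K\<^esub> (g x \<otimes>\<^bsub>K\<^esub> g y) \<otimes>\<^bsub>K\<^esub> inv\<^bsub>K\<^esub> h)"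
      using \<pi>_mult[of "?f x" "?f y"] conj_mult[OF gN[OF x] gN[OF y]] x y gN h N_mult N_inv
      by simp
    ultimately show ?thesis
      using x y gN h N_mult N_inv by (simp add: \<pi>_mult)
  qed
  moreover have "(\<lambda>x. \<pi> (?f x)) \<in> carrier G \<rightarrow> carrier Q"
    using f \<pi>_closed by blast
  ultimately show ?thesis
    unfolding weak_morphs_Ht_iff using f defect_one_iff by blast
qed

text \<open>
  The conjugate of \<open>g\<close> by \<open>h\<close> is itself a weak \<open>(L, Ht)\<close>-morph, although on \<open>L\<close> it may agree with
  \<open>\<theta>\<close> only modulo \<open>Ht\<close>; so it can serve as \<open>f'\<close>, with \<open>g' = g\<close>.
\<close>

lemma conjugate_classes:
  assumes f: "f \<in> Mt" and g: "g \<in> Mt" and h: "h \<in> H"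
  shows "(\<exists>f'\<in>class\<^sub>t f. \<exists>g'\<in>class\<^sub>t g. \<forall>x\<in>carrier G. f' x = h \<otimes>\<^bsub>K\<^esub> g' x \<otimes>\<^bsub>K\<^esub> inv\<^bsub>K\<^esub> h) \<longleftrightarrow>
    (\<forall>x\<in>carrier G. \<pi> (f x) = \<pi> (h \<otimes>\<^bsub>K\<^esub> g x \<otimes>\<^bsub>K\<^esub> inv\<^bsub>K\<^esub> h))" (is "?L \<longleftrightarrow> ?R")
proof -
  have hN: "h \<in> N" using h H_N by blast
  have N: "u x \<in> N" if "u \<in> weak_morphs G L KN Ht" "x \<in> carrier G" for u x
    using that by (auto simp: weak_morphs_Ht_iff)
  have mem_class: "v \<in> class\<^sub>t u \<longleftrightarrow> v \<in> weak_morphs G L KN Ht \<and> (\<forall>x\<in>carrier G. \<pi> (u x) = \<pi> (v x))"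
    if u: "u \<in> weak_morphs G L KN Ht" for u v
  proof (cases "v \<in> weak_morphs G L KN Ht")
    case True
    then have "v x \<in> \<pi> (u x) \<longleftrightarrow> \<pi> (u x) = \<pi> (v x)" if "x \<in> carrier G" for x
      using \<pi>_eq_iff[OF N[OF u that] N[OF True that]] by simp
    then show ?thesis
      using u True by (simp add: weak_class_def weak_equiv_def)
  qed (simp add: weak_class_def weak_equiv_def)
  note weak = f[THEN Mt_weak] g[THEN Mt_weak]
  show ?thesis
  proof
    assume ?L
    then obtain f' g' where f': "f' \<in> class\<^sub>t f" and g': "g' \<in> class\<^sub>t g"
      and conj: "\<forall>x\<in>carrier G. f' x = h \<otimes>\<^bsub>K\<^esub> g' x \<otimes>\<^bsub>K\<^esub> inv\<^bsub>K\<^esub> h" by blast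
    show ?R
    proof
      fix x assume x: "x \<in> carrier G"
      have "\<pi> (f x) = \<pi> (h \<otimes>\<^bsub>K\<^esub> g' x \<otimes>\<^bsub>K\<^esub> inv\<^bsub>K\<^esub> h)"
        using f' conj x mem_class[OF weak(1)] by simp
      moreover have "\<pi> (g x) = \<pi> (g' x)" "g' x \<in> N"
        using g' x mem_class[OF weak(2)] N by auto
      ultimately show "\<pi> (f x) = \<pi> (h \<otimes>\<^bsub>K\<^esub> g x \<otimes>\<^bsub>K\<^esub> inv\<^bsub>K\<^esub> h)"
        using hN N[OF weak(2) x] N_mult N_inv by (simp add: \<pi>_mult)
    qed
  next
    assume R: ?R
    let ?f = "\<lambda>x \<in> carrier G. h \<otimes>\<^bsub>K\<^esub> g x \<otimes>\<^bsub>K\<^esub> inv\<^bsub>K\<^esub> h"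
    have "?f \<in> class\<^sub>t f"
      using mem_class[OF weak(1)] conjugate_weak_morph[OF hN weak(2)] R by simp
    moreover have "g \<in> class\<^sub>t g"
      using mem_class[OF weak(2)] weak(2) by simp
    ultimately show ?L
      by (intro bexI[of _ ?f] bexI[of _ g]) simp_all
  qed
qed

lemma coboundary_orbit_conjugate:
  assumes f: "f \<in> Mt" and g: "g \<in> Mt"
  shows "class\<^sub>t g \<in> orbit (rel_B G L A \<rho> 1) translation (class\<^sub>t f) \<longleftrightarrow>
    (\<exists>h\<in>H. \<exists>f'\<in>class\<^sub>t f. \<exists>g'\<in>class\<^sub>t g.
      {f l \<otimes>\<^bsub>K\<^esub> h \<otimes>\<^bsub>K\<^esub> inv\<^bsub>K\<^esub> f l \<otimes>\<^bsub>K\<^esub> inv\<^bsub>K\<^esub> h | l. l \<in> L} \<subseteq> Ht \<and>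
      (\<forall>x\<in>carrier G. f' x = h \<otimes>\<^bsub>K\<^esub> g' x \<otimes>\<^bsub>K\<^esub> inv\<^bsub>K\<^esub> h))"
  unfolding coboundary_orbit[OF f g]
proof (rule bex_cong[OF refl], goal_cases)
  case (1 h)
  show ?case
    unfolding conjugate_classes[OF f g 1, symmetric] by blast
qed

end

theorem theorem5:
  fixes G :: "('a, 'm) monoid_scheme" and K :: "('b, 'n) monoid_scheme"
    and L :: "'a set" and H Ht N :: "'b set" and KN :: "('b, 'n) monoid_scheme"
    and A :: "'b set monoid"
    and \<theta> :: "'a \<Rightarrow> 'b" and \<rho> :: "'a \<Rightarrow> 'b set \<Rightarrow> 'b set"
    and Mt M :: "('a \<Rightarrow> 'b) set" and Et E :: "('a \<Rightarrow> 'b) set set"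
  assumes "group G" and "subgroup L G"
    and "group K" and "subgroup H K"
    and N: "N = normalizer K H" and KN: "KN = K\<lparr>carrier := N\<rparr>"
    and "\<theta> \<in> hom (G\<lparr>carrier := L\<rparr>) KN"
    and "subgroup Ht (K\<lparr>carrier := H\<rparr>)" and "Ht \<lhd> KN"
    and A: "A = K\<lparr>carrier := H\<rparr> Mod Ht" and "comm_group A"
    and "\<rho> \<in> hom G (AutoGroup A)"
    and Mt: "Mt = {f \<in> weak_morphs_rest G L KN Ht \<theta>. defines_action G K H Ht \<rho> f}"
    and M: "M = {f \<in> weak_morphs_rest G L K H \<theta>. defines_action G K H Ht \<rho> f}"
    and Et: "Et = weak_class G L KN Ht ` Mt"
    and E: "E = weak_class G L K H ` M"
  shows "\<exists>Res act Obs.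
    \<comment> \<open>(1)\<close>
    (Res \<in> Et \<rightarrow> E \<and>
     (\<forall>f \<in> Mt. Res (weak_class G L KN Ht f) = weak_class G L K H f)) \<and>
    \<comment> \<open>(2)\<close>
    (comm_group (rel_Z G L A \<rho> 1) \<and>
     free_action (rel_Z G L A \<rho> 1) Et act \<and>
     (\<forall>\<gamma> \<in> rel_cocycles G L A \<rho> 1. \<exists>\<gamma>d. is_lift G K H Ht \<gamma> \<gamma>d) \<and>
     (\<forall>\<gamma> \<in> rel_cocycles G L A \<rho> 1. \<forall>f \<in> Mt. \<forall>\<gamma>d. is_lift G K H Ht \<gamma> \<gamma>d \<longrightarrow>
        mult_left G K \<gamma>d f \<in> Mt \<and>
        act \<gamma> (weak_class G L KN Ht f) = weak_class G L KN Ht (mult_left G K \<gamma>d f))) \<and>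
    \<comment> \<open>(3)\<close>
    quotient_map_by_action (rel_Z G L A \<rho> 1) act Et (Res ` Et) Res \<and>
    \<comment> \<open>(4)\<close>
    (\<forall>f \<in> Mt. \<forall>g \<in> Mt.
       weak_class G L KN Ht g \<in> orbit (rel_B G L A \<rho> 1) act (weak_class G L KN Ht f) \<longleftrightarrow>
       (\<exists>h \<in> H. \<exists>f' \<in> weak_class G L KN Ht f. \<exists>g' \<in> weak_class G L KN Ht g.
          {f l \<otimes>\<^bsub>K\<^esub> h \<otimes>\<^bsub>K\<^esub> inv\<^bsub>K\<^esub> f l \<otimes>\<^bsub>K\<^esub> inv\<^bsub>K\<^esub> h | l. l \<in> L} \<subseteq> Ht \<and>
          (\<forall>x \<in> carrier G. f' x = h \<otimes>\<^bsub>K\<^esub> g' x \<otimes>\<^bsub>K\<^esub> inv\<^bsub>K\<^esub> h))) \<and>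
    \<comment> \<open>(5)\<close>
    (Obs \<in> E \<rightarrow> carrier (rel_H G L A \<rho> 2) \<and>
     (\<forall>f \<in> M. sharp G K Ht f \<in> rel_cocycles G L A \<rho> 2 \<and>
        Obs (weak_class G L K H f) = rel_H_class G L A \<rho> 2 (sharp G K Ht f))) \<and>
    \<comment> \<open>(6)\<close>
    Res ` Et = {c \<in> E. Obs c = \<one>\<^bsub>rel_H G L A \<rho> 2\<^esub>}"
proof -
  interpret weak_morph_extension G K L H Ht N KN A \<theta> \<rho> Mt M Et E
    using assms by (intro weak_morph_extension.intro)
  show ?thesis
  proof (rule exI[of _ restriction], rule exI[of _ translation], rule exI[of _ obstruction],
      intro conjI)
    show "restriction \<in> Et \<rightarrow> E"
      by (rule restriction_closed)
    show "\<forall>f\<in>Mt. restriction (weak_class G L KN Ht f) = weak_class G L K H f"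
      by (intro ballI restriction_class)
    show "comm_group (rel_Z G L A \<rho> 1)"
      by (rule comm_group_Z)
    show "free_action (rel_Z G L A \<rho> 1) Et translation"
      by (rule free_action_translation)
    show "\<forall>\<gamma>\<in>rel_cocycles G L A \<rho> 1. \<exists>\<gamma>d. is_lift G K H Ht \<gamma> \<gamma>d"
      by (intro ballI lift_exists rel_cocycles_1_cochain)
    show "\<forall>\<gamma>\<in>rel_cocycles G L A \<rho> 1. \<forall>f\<in>Mt. \<forall>\<gamma>d. is_lift G K H Ht \<gamma> \<gamma>d \<longrightarrow>
        mult_left G K \<gamma>d f \<in> Mt \<and>
        translation \<gamma> (weak_class G L KN Ht f) = weak_class G L KN Ht (mult_left G K \<gamma>d f)"
      by (intro ballI allI impI conjI mult_left_Mt translation_class)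
    show "quotient_map_by_action (rel_Z G L A \<rho> 1) translation Et (restriction ` Et) restriction"
      by (rule quotient_map_restriction)
    show "\<forall>f \<in> Mt. \<forall>g \<in> Mt.
       weak_class G L KN Ht g \<in> orbit (rel_B G L A \<rho> 1) translation (weak_class G L KN Ht f) \<longleftrightarrow>
       (\<exists>h \<in> H. \<exists>f' \<in> weak_class G L KN Ht f. \<exists>g' \<in> weak_class G L KN Ht g.
          {f l \<otimes>\<^bsub>K\<^esub> h \<otimes>\<^bsub>K\<^esub> inv\<^bsub>K\<^esub> f l \<otimes>\<^bsub>K\<^esub> inv\<^bsub>K\<^esub> h | l. l \<in> L} \<subseteq> Ht \<and>
          (\<forall>x \<in> carrier G. f' x = h \<otimes>\<^bsub>K\<^esub> g' x \<otimes>\<^bsub>K\<^esub> inv\<^bsub>K\<^esub> h))"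
      by (intro ballI coboundary_orbit_conjugate)
    show "obstruction \<in> E \<rightarrow> carrier (rel_H G L A \<rho> 2)"
      by (rule obstruction_closed)
    show "\<forall>f\<in>M. sharp G K Ht f \<in> rel_cocycles G L A \<rho> 2 \<and>
        obstruction (weak_class G L K H f) = rel_H_class G L A \<rho> 2 (sharp G K Ht f)"
      by (intro ballI conjI sharp_cocycle obstruction_class)
    show "restriction ` Et = {c \<in> E. obstruction c = \<one>\<^bsub>rel_H G L A \<rho> 2\<^esub>}"
      by (rule exactness)
  qed
qed


end
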